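(* The problem "is a given composite state stable?" is algorithmically decidable for CFSM protocols with the rational channel property whose communication graph has two nodes $0,1$ and two parallel edges $\alpha,\beta$, both from $0$ to $1$.
   Context: A CFSM protocol $\mathbf P$ has a finite directed communication graph $G=(N,E)$ (edge $\xi$ has tail $-\xi$, head $+\xi$), pairwise disjoint finite message sets $M_\xi$, and for each $j\in N$ a finite state machine $F_j=(K_j,\Sigma_j,T_j,h_j)$: finite state set $K_j$, initial state $h_j$, alphabet $\Sigma_j=\{+b: b\in M_\xi,\ j=+\xi\}\cup\{-b: b\in M_\xi,\ j=-\xi\}$, transitions $T_j\subseteq K_j\times\Sigma_j\times K_j$ ($+b$ = receive, $-b$ = send). A composite state is $S=(p_j:j\in N)$; a channel content is $C=(x_\xi:\xi\in E)$, $x_\xi\in M_\xi^*$; global states are pairs $(S,C)$; $C^0$ has all components empty; $S^0=(h_j:j\in N)$. A step: some machine $F_i$ takes $p_i\xrightarrow{-b}q_i$ with $b\in M_\beta$, $i=-\beta$, appending $b$ to the end of $x_\beta$; or takes $p_i\xrightarrow{+b}q_i$ with $b\in M_\beta$, $i=+\beta$, provided $x_\beta$ begins with $b$, removing it; all else unchanged. Reachable means reachable from $(S^0,C^0)$ by finitely many steps. A composite state $S$ is stable if $(S,C^0)$ is reachable. $\mathbf P$ has the rational channel property if for each composite state $S$ the set $\mathbf L(S)=\{C:(S,C)\text{ reachable}\}$ is a rational subset of the monoid $\prod_{\xi\in E}M_\xi^*$ (i.e. belongs to the smallest family containing finite sets and closed under union, componentwise product and Kleene star). *)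

theory Defs
  imports Main "HOL-Library.Nat_Bijection"
begin

datatype 'm act = Send 'm | Recv 'm

record ('n, 'e, 'm, 's) cfsm =
  nodes  :: "'n set"
  edges  :: "'e set"
  tail   :: "'e \<Rightarrow> 'n"
  head   :: "'e \<Rightarrow> 'n"
  msgs   :: "'e \<Rightarrow> 'm set"
  states :: "'n \<Rightarrow> 's set"
  init   :: "'n \<Rightarrow> 's"
  trans  :: "'n \<Rightarrow> ('s \<times> 'm act \<times> 's) set"

definition alphabet :: "('n, 'e, 'm, 's) cfsm \<Rightarrow> 'n \<Rightarrow> 'm act set" where
  "alphabet P j =
     {Recv b | b \<xi>. \<xi> \<in> edges P \<and> b \<in> msgs P \<xi> \<and> j = head P \<xi>} \<union>
     {Send b | b \<xi>. \<xi> \<in> edges P \<and> b \<in> msgs P \<xi> \<and> j = tail P \<xi>}"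

definition wf_cfsm :: "('n, 'e, 'm, 's) cfsm \<Rightarrow> bool" where
  "wf_cfsm P \<longleftrightarrow>
     finite (nodes P) \<and> finite (edges P) \<and>
     (\<forall>\<xi>\<in>edges P. tail P \<xi> \<in> nodes P \<and> head P \<xi> \<in> nodes P) \<and>
     (\<forall>\<xi>\<in>edges P. finite (msgs P \<xi>)) \<and>
     (\<forall>\<xi>\<in>edges P. \<forall>\<eta>\<in>edges P. \<xi> \<noteq> \<eta> \<longrightarrow> msgs P \<xi> \<inter> msgs P \<eta> = {}) \<and>
     (\<forall>j\<in>nodes P. finite (states P j) \<and> init P j \<in> states P j \<and>
        trans P j \<subseteq> states P j \<times> alphabet P j \<times> states P j)"

text \<open>Global states: (composite state, channel content). Channel contents are
  functions on edges; components outside the edge set are always empty.\<close>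

inductive step :: "('n, 'e, 'm, 's) cfsm \<Rightarrow> ('n \<Rightarrow> 's) \<times> ('e \<Rightarrow> 'm list)
                    \<Rightarrow> ('n \<Rightarrow> 's) \<times> ('e \<Rightarrow> 'm list) \<Rightarrow> bool" for P where
  send: "\<lbrakk> i \<in> nodes P; \<beta> \<in> edges P; b \<in> msgs P \<beta>; i = tail P \<beta>;
          (S i, Send b, q) \<in> trans P i \<rbrakk>
         \<Longrightarrow> step P (S, C) (S(i := q), C(\<beta> := C \<beta> @ [b]))"
| recv: "\<lbrakk> i \<in> nodes P; \<beta> \<in> edges P; b \<in> msgs P \<beta>; i = head P \<beta>;
          (S i, Recv b, q) \<in> trans P i; C \<beta> = b # x \<rbrakk>
         \<Longrightarrow> step P (S, C) (S(i := q), C(\<beta> := x))"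

definition empty_chan :: "'e \<Rightarrow> 'm list" where
  "empty_chan = (\<lambda>_. [])"

definition reachable :: "('n, 'e, 'm, 's) cfsm \<Rightarrow> ('n \<Rightarrow> 's) \<times> ('e \<Rightarrow> 'm list) \<Rightarrow> bool" where
  "reachable P g \<longleftrightarrow> (step P)\<^sup>*\<^sup>* (init P, empty_chan) g"

definition composite_state :: "('n, 'e, 'm, 's) cfsm \<Rightarrow> ('n \<Rightarrow> 's) \<Rightarrow> bool" where
  "composite_state P S \<longleftrightarrow> (\<forall>j\<in>nodes P. S j \<in> states P j)"

definition stable :: "('n, 'e, 'm, 's) cfsm \<Rightarrow> ('n \<Rightarrow> 's) \<Rightarrow> bool" where
  "stable P S \<longleftrightarrow> reachable P (S, empty_chan)"

definition chanL :: "('n, 'e, 'm, 's) cfsm \<Rightarrow> ('n \<Rightarrow> 's) \<Rightarrow> ('e \<Rightarrow> 'm list) set" where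
  "chanL P S = {C. reachable P (S, C)}"

definition chan_monoid :: "('n, 'e, 'm, 's) cfsm \<Rightarrow> ('e \<Rightarrow> 'm list) set" where
  "chan_monoid P = {C. \<forall>\<xi>. (\<xi> \<in> edges P \<longrightarrow> set (C \<xi>) \<subseteq> msgs P \<xi>) \<and>
                          (\<xi> \<notin> edges P \<longrightarrow> C \<xi> = [])}"

definition cmult :: "('e \<Rightarrow> 'm list) \<Rightarrow> ('e \<Rightarrow> 'm list) \<Rightarrow> ('e \<Rightarrow> 'm list)" where
  "cmult x y = (\<lambda>\<xi>. x \<xi> @ y \<xi>)"

definition setprod :: "('e \<Rightarrow> 'm list) set \<Rightarrow> ('e \<Rightarrow> 'm list) set \<Rightarrow> ('e \<Rightarrow> 'm list) set" where
  "setprod A B = {cmult x y | x y. x \<in> A \<and> y \<in> B}"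

inductive_set kstar :: "('e \<Rightarrow> 'm list) set \<Rightarrow> ('e \<Rightarrow> 'm list) set" for A where
  unit: "empty_chan \<in> kstar A"
| mult: "a \<in> A \<Longrightarrow> x \<in> kstar A \<Longrightarrow> cmult a x \<in> kstar A"

inductive_set rational_sets :: "('e \<Rightarrow> 'm list) set \<Rightarrow> ('e \<Rightarrow> 'm list) set set" for Mon where
  fin:   "finite A \<Longrightarrow> A \<subseteq> Mon \<Longrightarrow> A \<in> rational_sets Mon"
| union: "A \<in> rational_sets Mon \<Longrightarrow> B \<in> rational_sets Mon \<Longrightarrow> A \<union> B \<in> rational_sets Mon"
| prod:  "A \<in> rational_sets Mon \<Longrightarrow> B \<in> rational_sets Mon \<Longrightarrow> setprod A B \<in> rational_sets Mon"
| star:  "A \<in> rational_sets Mon \<Longrightarrow> kstar A \<in> rational_sets Mon"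

definition rational_channel_property :: "('n, 'e, 'm, 's) cfsm \<Rightarrow> bool" where
  "rational_channel_property P \<longleftrightarrow>
     (\<forall>S. composite_state P S \<longrightarrow> chanL P S \<in> rational_sets (chan_monoid P))"

section \<open>The specific communication graph: nodes 0,1 (False,True), edges alpha,beta (False,True) from 0 to 1\<close>

definition two_parallel_graph :: "(bool, bool, 'm, 's) cfsm \<Rightarrow> bool" where
  "two_parallel_graph P \<longleftrightarrow>
     nodes P = UNIV \<and> edges P = UNIV \<and> tail P = (\<lambda>_. False) \<and> head P = (\<lambda>_. True)"

datatype recf = Zero | Succ | Proj nat | Comp recf "recf list" | Pr recf recf | Mu recf

inductive eval :: "recf \<Rightarrow> nat list \<Rightarrow> nat \<Rightarrow> bool" where
  "eval Zero xs 0"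
| "eval Succ (x # xs) (Suc x)"
| "i < length xs \<Longrightarrow> eval (Proj i) xs (xs ! i)"
| "length ys = length gs \<Longrightarrow> (\<forall>k<length gs. eval (gs ! k) xs (ys ! k)) \<Longrightarrow> eval f ys z
    \<Longrightarrow> eval (Comp f gs) xs z"
| "eval f xs z \<Longrightarrow> eval (Pr f g) (0 # xs) z"
| "eval (Pr f g) (n # xs) y \<Longrightarrow> eval g (n # y # xs) z \<Longrightarrow> eval (Pr f g) (Suc n # xs) z"
| "eval f (n # xs) 0 \<Longrightarrow> (\<forall>m<n. \<exists>y. eval f (m # xs) (Suc y)) \<Longrightarrow> eval (Mu f) xs n"

definition enc_set :: "nat set \<Rightarrow> nat" where
  "enc_set A = list_encode (sorted_list_of_set A)"

fun enc_act :: "nat act \<Rightarrow> nat" where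
  "enc_act (Send b) = 2 * b"
| "enc_act (Recv b) = 2 * b + 1"

definition enc_trans :: "(nat \<times> nat act \<times> nat) set \<Rightarrow> nat" where
  "enc_trans T = enc_set ((\<lambda>(p, a, q). prod_encode (p, prod_encode (enc_act a, q))) ` T)"

definition encode_instance :: "(bool, bool, nat, nat) cfsm \<Rightarrow> (bool \<Rightarrow> nat) \<Rightarrow> nat" where
  "encode_instance P S = list_encode
     [enc_set (msgs P False), enc_set (msgs P True),
      enc_set (states P False), enc_set (states P True),
      init P False, init P True,
      enc_trans (trans P False), enc_trans (trans P True),
      S False, S True]"

end

theory Submission
  imports Defs "HOL-Library.FuncSet"
begin

text \<open>Stability is semidecidable by searching for a run, so it suffices to semidecide instability.
  Node 0 only sends and node 1 only receives. In any run, stop node 0 as soon as it has sent everything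
  that node 1 has consumed: at that point at least one of the two channels is empty. Hence the
  reachable configurations are determined by the languages
  \<open>D\<^sub>k(p, q)\<close> of words \<open>x\<close> such that \<open>(p, q)\<close> is reachable with content \<open>x\<close> in channel \<open>k\<close> and the other
  channel empty. They are slices of rational relations, hence regular under the rational channel
  property, and they are closed under four local rules. Conversely, any family of regular
  languages closed under these rules over-approximates the \<open>D\<^sub>k(p, q)\<close>, and closure is checkable for
  languages given by a finite congruence. So instability is certified by a finite congruence
  together with a closed family that excludes the empty word at the given composite state.\<close>

section \<open>Computable functions\<close>

text \<open>The rational channel property asserts that descriptions exist without supplying them, so
  they must be guessed and checked. For guessed relations on the full channel contents this would
  mean checking inclusions between rational relations, which is undecidable in general; contents
  with one empty channel are single words, and for regular languages of words the check is finite.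

  The channel that is empty at the stopping point is the one that carried the last message sent so
  far: that message has been consumed, and by the queue discipline so has everything before it. The
  later sends can be postponed to the end, since node 1 consumes nothing that they supply and node 0
  waits for nobody. The four rules are the moves before that point: with both channels empty their
  roles are exchanged; a send or a receive on channel \<open>k\<close> changes the word; a message
  on the other channel is sent and consumed at once. Sends act on the right end of a word and
  receives on the left end, which is why a two-sided congruence is guessed.\<close>

text \<open>An argument list plays the role of an environment: binding a variable pushes it to the front,
  so that \<open>hd (tl (\<dots> xs))\<close> is the variable with the corresponding de Bruijn index. Asking for a
  program at every sufficiently large arity frees the closure rules from arity bookkeeping.\<close>

definition computable :: "(nat list \<Rightarrow> nat) \<Rightarrow> bool" where
  "computable F \<longleftrightarrow> (\<exists>n. \<forall>m\<ge>n. \<exists>f. \<forall>xs. length xs = m \<longrightarrow> eval f xs (F xs))"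

definition decidable :: "(nat list \<Rightarrow> bool) \<Rightarrow> bool" where
  "decidable P \<longleftrightarrow> computable (\<lambda>xs. of_bool (P xs))"

text \<open>The list of inner values may be shorter than the arities at which \<open>F\<close> has a
  program; the trailing zeros lift it to an admissible length. For the inner functions a common
  arity threshold is the maximum of finitely many.\<close>

lemma computable_comp:
  assumes F: "computable F" and Gs: "\<And>G. G \<in> set Gs \<Longrightarrow> computable G"
  shows "\<exists>k. computable (\<lambda>xs. F (map (\<lambda>G. G xs) Gs @ replicate k 0))"
proof -
  obtain k where k: "\<And>m. m \<ge> k \<Longrightarrow> \<exists>f. \<forall>xs. length xs = m \<longrightarrow> eval f xs (F xs)"
    using F unfolding computable_def by blast
  have "\<forall>G\<in>set Gs. \<exists>n. \<forall>m\<ge>n. \<exists>f. \<forall>xs. length xs = m \<longrightarrow> eval f xs (G xs)"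
    using Gs unfolding computable_def by blast
  then obtain N where N: "\<And>G m. G \<in> set Gs \<Longrightarrow> m \<ge> N G \<Longrightarrow>
      \<exists>f. \<forall>xs. length xs = m \<longrightarrow> eval f xs (G xs)"
    by metis
  define n where "n = Max (insert 0 (N ` set Gs))"
  have Nn: "N G \<le> n" if "G \<in> set Gs" for G
    unfolding n_def using that by (intro Max_ge) auto
  have "\<exists>f. \<forall>xs. length xs = m \<longrightarrow> eval f xs (F (map (\<lambda>G. G xs) Gs @ replicate k 0))"
    if m: "m \<ge> n" for m
  proof -
    have "\<forall>G\<in>set Gs. \<exists>f. \<forall>xs. length xs = m \<longrightarrow> eval f xs (G xs)"
    proof
      fix G assume "G \<in> set Gs"
      with N[of G m] Nn[of G] m show "\<exists>f. \<forall>xs. length xs = m \<longrightarrow> eval f xs (G xs)" by simp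
    qed
    then obtain g where g: "\<And>G xs. G \<in> set Gs \<Longrightarrow> length xs = m \<Longrightarrow> eval (g G) xs (G xs)"
      by metis
    obtain f where f: "\<And>xs. length xs = length Gs + k \<Longrightarrow> eval f xs (F xs)"
      using k[of "length Gs + k"] by auto
    have "eval (Comp f (map g Gs @ replicate k Zero)) xs (F (map (\<lambda>G. G xs) Gs @ replicate k 0))"
      if "length xs = m" for xs
      by (rule eval.intros(4)[where ys = "map (\<lambda>G. G xs) Gs @ replicate k 0"])
        (auto simp: nth_append that intro: f g eval.intros)
    then show ?thesis by blast
  qed
  then show ?thesis unfolding computable_def by blast
qed

text \<open>Serves functions \<open>g\<close> whose definition binds variables: under a binder the
  environment has grown, and nothing is assumed about \<open>F\<close> there. So \<open>g\<close> is
  treated on plain variables first and the arguments are substituted afterwards.\<close>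

lemma computable_comp1:
  assumes "computable (\<lambda>xs. g (hd xs))" "computable F"
  shows "computable (\<lambda>xs. g (F xs))"
  using computable_comp[OF assms(1), of "[F]"] assms(2) by simp

lemma computable_comp2:
  assumes "computable (\<lambda>xs. g (hd xs) (hd (tl xs)))" "computable F" "computable G"
  shows "computable (\<lambda>xs. g (F xs) (G xs))"
  using computable_comp[OF assms(1), of "[F, G]"] assms(2,3) by auto

lemma computable_hd_drop: "computable (\<lambda>xs. hd (drop i xs))"
  unfolding computable_def
proof (intro exI[of _ "Suc i"] allI impI)
  fix m assume "Suc i \<le> m"
  then show "\<exists>f. \<forall>xs. length xs = m \<longrightarrow> eval f xs (hd (drop i xs))"
    by (intro exI[of _ "Proj i"]) (auto simp: hd_drop_conv_nth intro!: eval.intros)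
qed

text \<open>Twelve indices suffice: the deepest condition of a certificate binds seven variables on
  top of the two arguments \<open>w\<close> and \<open>c\<close>.\<close>

lemmas computable_var =
  computable_hd_drop[of 0, simplified drop_0]
  computable_hd_drop[of "Suc 0", simplified drop_Suc drop_0]
  computable_hd_drop[of "Suc (Suc 0)", simplified drop_Suc drop_0]
  computable_hd_drop[of "Suc (Suc (Suc 0))", simplified drop_Suc drop_0]
  computable_hd_drop[of "Suc (Suc (Suc (Suc 0)))", simplified drop_Suc drop_0]
  computable_hd_drop[of "Suc (Suc (Suc (Suc (Suc 0))))", simplified drop_Suc drop_0]
  computable_hd_drop[of "Suc (Suc (Suc (Suc (Suc (Suc 0)))))", simplified drop_Suc drop_0]
  computable_hd_drop[of "Suc (Suc (Suc (Suc (Suc (Suc (Suc 0))))))", simplified drop_Suc drop_0]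
  computable_hd_drop[of "Suc (Suc (Suc (Suc (Suc (Suc (Suc (Suc 0)))))))", simplified drop_Suc drop_0]
  computable_hd_drop[of "Suc (Suc (Suc (Suc (Suc (Suc (Suc (Suc (Suc 0))))))))", simplified drop_Suc drop_0]
  computable_hd_drop[of "Suc (Suc (Suc (Suc (Suc (Suc (Suc (Suc (Suc (Suc 0)))))))))", simplified drop_Suc drop_0]
  computable_hd_drop[of "Suc (Suc (Suc (Suc (Suc (Suc (Suc (Suc (Suc (Suc (Suc 0))))))))))", simplified drop_Suc drop_0]

text \<open>\<open>Pr\<close> puts the counter and the previous value in front of its parameters, so
  the step program is taken at arity \<open>m + 2\<close>. The parameters are the whole environment,
  copied by projections behind the recursion bound.\<close>

lemma computable_rec_nat:
  assumes B: "computable B" and St: "computable (\<lambda>ys. St (hd ys) (hd (tl ys)) (tl (tl ys)))"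
    and F: "computable F"
  shows "computable (\<lambda>xs. rec_nat (B xs) (\<lambda>i r. St i r xs) (F xs))"
proof -
  obtain n1 where n1: "\<And>m. m \<ge> n1 \<Longrightarrow> \<exists>f. \<forall>xs. length xs = m \<longrightarrow> eval f xs (B xs)"
    using B unfolding computable_def by blast
  obtain n2 where n2: "\<And>m. m \<ge> n2 \<Longrightarrow>
      \<exists>f. \<forall>xs. length xs = m \<longrightarrow> eval f xs (St (hd xs) (hd (tl xs)) (tl (tl xs)))"
    using St unfolding computable_def by blast
  obtain n3 where n3: "\<And>m. m \<ge> n3 \<Longrightarrow> \<exists>f. \<forall>xs. length xs = m \<longrightarrow> eval f xs (F xs)"
    using F unfolding computable_def by blast
  show ?thesis
    unfolding computable_def
  proof (intro exI[of _ "max n1 (max n2 n3)"] allI impI)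
    fix m assume m: "m \<ge> max n1 (max n2 n3)"
    obtain b where b: "\<And>xs. length xs = m \<Longrightarrow> eval b xs (B xs)" using n1[of m] m by auto
    obtain s where s: "\<And>xs. length xs = m + 2 \<Longrightarrow> eval s xs (St (hd xs) (hd (tl xs)) (tl (tl xs)))"
      using n2[of "m + 2"] m by auto
    obtain f where f: "\<And>xs. length xs = m \<Longrightarrow> eval f xs (F xs)" using n3[of m] m by auto
    have pr: "eval (Pr b s) (k # xs) (rec_nat (B xs) (\<lambda>i r. St i r xs) k)" if "length xs = m" for k xs
    proof (induction k)
      case 0
      show ?case using b that by (auto intro: eval.intros)
    next
      case (Suc k)
      show ?case
        using eval.intros(6)[OF Suc s] that by simp
    qed
    have "eval (Comp (Pr b s) (f # map Proj [0..<m])) xs (rec_nat (B xs) (\<lambda>i r. St i r xs) (F xs))"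
      if xs: "length xs = m" for xs
    proof (rule eval.intros(4)[where ys = "F xs # xs"])
      show "\<forall>k<length (f # map Proj [0..<m]). eval ((f # map Proj [0..<m]) ! k) xs ((F xs # xs) ! k)"
        using f xs by (auto simp: nth_Cons' intro!: eval.intros)
    qed (use xs pr in auto)
    then show "\<exists>f. \<forall>xs. length xs = m \<longrightarrow> eval f xs (rec_nat (B xs) (\<lambda>i r. St i r xs) (F xs))"
      by blast
  qed
qed

lemma computable_Suc:
  assumes "computable F"
  shows "computable (\<lambda>xs. Suc (F xs))"
proof (rule computable_comp1[OF _ assms])
  have "eval Succ xs (Suc (hd xs))" if "length xs \<ge> 1" for xs
    using that by (cases xs) (auto intro: eval.intros)
  then show "computable (\<lambda>xs. Suc (hd xs))"
    unfolding computable_def by blast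
qed

lemma computable_const: "computable (\<lambda>xs. c)"
proof (induction c)
  case 0
  show ?case unfolding computable_def by (auto intro: eval.intros)
next
  case (Suc c)
  then show ?case by (rule computable_Suc)
qed

lemma computable_add:
  assumes "computable F" "computable G"
  shows "computable (\<lambda>xs. F xs + G xs)"
proof -
  have "computable (\<lambda>xs. rec_nat (F xs) (\<lambda>i r. Suc r) (G xs))"
    by (intro computable_rec_nat computable_Suc computable_var assms)
  moreover have "rec_nat a (\<lambda>i r. Suc r) b = a + b" for a b by (induction b) auto
  ultimately show ?thesis by simp
qed

text \<open>Removes the accumulator of a recursion from the environment, so that the summand of a
  sum sees only its index and the outer variables.\<close>

lemma computable_skip_second:
  assumes "computable G"
  shows "computable (\<lambda>ys. G (hd ys # tl (tl ys)))"
proof -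
  obtain n where n: "\<And>m. m \<ge> n \<Longrightarrow> \<exists>f. \<forall>xs. length xs = m \<longrightarrow> eval f xs (G xs)"
    using assms unfolding computable_def by blast
  show ?thesis
    unfolding computable_def
  proof (intro exI[of _ "n + 2"] allI impI)
    fix m assume m: "m \<ge> n + 2"
    then have "m - 1 \<ge> n" by simp
    then obtain g where g: "\<And>xs. length xs = m - 1 \<Longrightarrow> eval g xs (G xs)"
      using n by blast
    have "eval (Comp g (Proj 0 # map Proj [2..<m])) xs (G (hd xs # tl (tl xs)))"
      if xs: "length xs = m" for xs
    proof (rule eval.intros(4)[where ys = "hd xs # tl (tl xs)"])
      obtain x y zs where "xs = x # y # zs"
        using xs m by (cases xs; cases "tl xs") auto
      moreover have "eval (Proj (Suc (Suc k))) (x # y # zs) (zs ! k)" if "k < length zs" for k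
        using eval.intros(3)[of "Suc (Suc k)" "x # y # zs"] that by simp
      moreover have "eval (Proj 0) (x # y # zs) x"
        using eval.intros(3)[of 0 "x # y # zs"] by simp
      ultimately show "\<forall>k<length (Proj 0 # map Proj [2..<m]).
          eval ((Proj 0 # map Proj [2..<m]) ! k) xs ((hd xs # tl (tl xs)) ! k)"
        using xs by (auto simp: less_Suc_eq_0_disj simp del: upt_Suc)
    qed (use xs m g in auto)
    then show "\<exists>f. \<forall>xs. length xs = m \<longrightarrow> eval f xs (G (hd xs # tl (tl xs)))" by blast
  qed
qed

lemma computable_sum:
  assumes "computable F" "computable (\<lambda>ys. G (hd ys) (tl ys))"
  shows "computable (\<lambda>xs. \<Sum>i<F xs. G i xs)"
proof -
  have "computable (\<lambda>xs. rec_nat 0 (\<lambda>i r. r + G i xs) (F xs))"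
    using computable_skip_second[OF assms(2)]
    by (intro computable_rec_nat computable_add computable_const computable_var assms(1)) simp
  moreover have "rec_nat 0 (\<lambda>i r. r + g i) b = (\<Sum>i<b. g i)" for b and g :: "nat \<Rightarrow> nat"
    by (induction b) auto
  ultimately show ?thesis by simp
qed

lemma computable_mult:
  assumes "computable F" "computable G"
  shows "computable (\<lambda>xs. F xs * G xs)"
proof (rule computable_comp2[OF _ assms])
  have "computable (\<lambda>xs. \<Sum>i<hd xs. hd (tl xs))"
    by (intro computable_sum computable_var)
  then show "computable (\<lambda>xs. hd xs * hd (tl xs))" by simp
qed

lemma computable_pred:
  assumes "computable F"
  shows "computable (\<lambda>xs. F xs - 1)"
proof -
  have "computable (\<lambda>xs. rec_nat 0 (\<lambda>i r. i) (F xs))"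
    by (intro computable_rec_nat computable_const computable_var assms)
  moreover have "rec_nat 0 (\<lambda>i r. i) b = b - 1" for b by (cases b) auto
  ultimately show ?thesis by simp
qed

lemma computable_diff:
  assumes "computable F" "computable G"
  shows "computable (\<lambda>xs. F xs - G xs)"
proof -
  have "computable (\<lambda>xs. rec_nat (F xs) (\<lambda>i r. r - 1) (G xs))"
    by (intro computable_rec_nat computable_pred computable_var assms)
  moreover have "rec_nat a (\<lambda>i r. r - 1) b = a - b" for a b :: nat by (induction b) auto
  ultimately show ?thesis by simp
qed

section \<open>Decidable predicates and bounded quantifiers\<close>

lemma decidable_less:
  assumes "computable F" "computable G"
  shows "decidable (\<lambda>xs. F xs < G xs)"
proof -
  have "computable (\<lambda>xs. 1 - (Suc (F xs) - G xs))"
    by (intro computable_diff computable_Suc computable_const assms)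
  moreover have "1 - (Suc a - b) = of_bool (a < b)" for a b :: nat by auto
  ultimately show ?thesis by (simp add: decidable_def)
qed

lemma decidable_not:
  assumes "decidable P"
  shows "decidable (\<lambda>xs. \<not> P xs)"
proof -
  have "computable (\<lambda>xs. 1 - of_bool (P xs))"
    using assms unfolding decidable_def by (intro computable_diff computable_const)
  moreover have "1 - of_bool b = (of_bool (\<not> b) :: nat)" for b by simp
  ultimately show ?thesis unfolding decidable_def by (simp only:)
qed

lemma decidable_conj:
  assumes "decidable P" "decidable Q"
  shows "decidable (\<lambda>xs. P xs \<and> Q xs)"
  unfolding decidable_def of_bool_conj
  using assms unfolding decidable_def by (rule computable_mult)

lemma decidable_disj:
  assumes "decidable P" "decidable Q"
  shows "decidable (\<lambda>xs. P xs \<or> Q xs)"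
  using decidable_not[OF decidable_conj[OF decidable_not[OF assms(1)] decidable_not[OF assms(2)]]]
  by simp

lemma decidable_imp:
  assumes "decidable P" "decidable Q"
  shows "decidable (\<lambda>xs. P xs \<longrightarrow> Q xs)"
  unfolding imp_conv_disj by (intro decidable_disj decidable_not assms)

lemma decidable_le:
  assumes "computable F" "computable G"
  shows "decidable (\<lambda>xs. F xs \<le> G xs)"
  using decidable_not[OF decidable_less[OF assms(2,1)]] by (simp add: not_less)

lemma decidable_eq:
  assumes "computable F" "computable G"
  shows "decidable (\<lambda>xs. F xs = G xs)"
  using decidable_conj[OF decidable_le[OF assms] decidable_le[OF assms(2,1)]]
  by (simp flip: order.eq_iff)

lemma decidable_ex_less:
  assumes "computable F" "decidable (\<lambda>ys. P (hd ys) (tl ys))"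
  shows "decidable (\<lambda>xs. \<exists>i<F xs. P i xs)"
proof -
  have "decidable (\<lambda>xs. 0 < (\<Sum>i<F xs. of_bool (P i xs) :: nat))"
    using assms unfolding decidable_def[of "\<lambda>ys. P (hd ys) (tl ys)"]
    by (intro decidable_less computable_const computable_sum)
  moreover have "0 < (\<Sum>i<n. of_bool (Q i) :: nat) \<longleftrightarrow> (\<exists>i<n. Q i)" for n and Q :: "nat \<Rightarrow> bool"
    by (subst zero_less_iff_neq_zero, subst sum_eq_0_iff) auto
  ultimately show ?thesis by simp
qed

lemma decidable_all_less:
  assumes "computable F" "decidable (\<lambda>ys. P (hd ys) (tl ys))"
  shows "decidable (\<lambda>xs. \<forall>i<F xs. P i xs)"
  using decidable_not[OF decidable_ex_less[OF assms(1) decidable_not[OF assms(2)]]] by simp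

lemma decidable_ex_le:
  assumes "computable F" "decidable (\<lambda>ys. P (hd ys) (tl ys))"
  shows "decidable (\<lambda>xs. \<exists>i\<le>F xs. P i xs)"
  using decidable_ex_less[OF computable_Suc[OF assms(1)] assms(2)] by (simp add: less_Suc_eq_le)

lemma decidable_all_le:
  assumes "computable F" "decidable (\<lambda>ys. P (hd ys) (tl ys))"
  shows "decidable (\<lambda>xs. \<forall>i\<le>F xs. P i xs)"
  using decidable_all_less[OF computable_Suc[OF assms(1)] assms(2)] by (simp add: less_Suc_eq_le)

lemmas computable_intros =
  computable_var computable_const computable_Suc computable_add computable_mult computable_diff
  computable_sum decidable_less decidable_le decidable_eq decidable_not decidable_conj
  decidable_disj decidable_imp decidable_ex_less decidable_all_less decidable_ex_le decidable_all_le

lemma computable_of_bool: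
  assumes "decidable P"
  shows "computable (\<lambda>xs. of_bool (P xs))"
  using assms by (simp add: decidable_def)

section \<open>Pairing, list codes and finite tables\<close>

definition pair :: "nat \<Rightarrow> nat \<Rightarrow> nat" where
  "pair a b = prod_encode (a, b)"

lemma computable_pair:
  assumes "computable F" "computable G"
  shows "computable (\<lambda>xs. pair (F xs) (G xs))"
proof -
  have "triangle n = (\<Sum>i<n. Suc i)" for n by (induction n) auto
  then have "pair a b = (\<Sum>i<a+b. Suc i) + a" for a b by (simp add: pair_def prod_encode_def)
  moreover have "computable (\<lambda>xs. (\<Sum>i<F xs + G xs. Suc i) + F xs)"
    by (intro computable_intros assms)
  ultimately show ?thesis by simp
qed

lemma pair_decode: "pair (fst (prod_decode z)) (snd (prod_decode z)) = z"
  by (simp add: pair_def)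

text \<open>Bounded search written as a sum: the components of a pair are at most its code, and the
  only summand that can be nonzero is the wanted component.\<close>

lemma computable_fst_decode:
  assumes "computable F"
  shows "computable (\<lambda>xs. fst (prod_decode (F xs)))"
proof (rule computable_comp1[OF _ assms])
  have "(\<Sum>a<Suc z. a * of_bool (\<exists>b\<le>z. pair a b = z)) = fst (prod_decode z)" for z
  proof -
    obtain a b where ab: "prod_decode z = (a, b)" by force
    have z: "pair a b = z" using pair_decode[of z] ab by simp
    have "(\<Sum>c<Suc z. c * of_bool (\<exists>b\<le>z. pair c b = z)) = (\<Sum>c<Suc z. if c = a then c else 0)"
      using z le_prod_encode_2[of b a]
      by (intro sum.cong) (auto simp: pair_def)
    also have "\<dots> = a"
      using z le_prod_encode_1[of a b] by (subst sum.delta) (auto simp: pair_def)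
    finally show ?thesis using ab by simp
  qed
  moreover have "computable (\<lambda>xs. \<Sum>a<Suc (hd xs). a * of_bool (\<exists>b\<le>hd xs. pair a b = hd xs))"
    by (intro computable_intros computable_of_bool computable_pair)
  ultimately show "computable (\<lambda>xs. fst (prod_decode (hd xs)))" by simp
qed

lemma computable_snd_decode:
  assumes "computable F"
  shows "computable (\<lambda>xs. snd (prod_decode (F xs)))"
proof (rule computable_comp1[OF _ assms])
  have "(\<Sum>b<Suc z. b * of_bool (pair (fst (prod_decode z)) b = z)) = snd (prod_decode z)" for z
  proof -
    obtain a b where ab: "prod_decode z = (a, b)" by force
    have z: "pair a b = z" using pair_decode[of z] ab by simp
    have "(\<Sum>c<Suc z. c * of_bool (pair a c = z)) = (\<Sum>c<Suc z. if c = b then c else 0)"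
      using z by (intro sum.cong) (auto simp: pair_def)
    also have "\<dots> = b"
      using z le_prod_encode_2[of b a] by (subst sum.delta) (auto simp: pair_def)
    finally show ?thesis using ab by simp
  qed
  moreover have "computable (\<lambda>xs. \<Sum>b<Suc (hd xs). b * of_bool (pair (fst (prod_decode (hd xs))) b = hd xs))"
    by (intro computable_intros computable_of_bool computable_pair computable_fst_decode)
  ultimately show "computable (\<lambda>xs. snd (prod_decode (hd xs)))" by simp
qed

text \<open>Since \<open>list_encode (x # xs) = Suc (prod_encode (x, list_encode xs))\<close>, head and tail act on
  codes as projections; the code \<open>0\<close> of the empty list is sent to \<open>0\<close>.\<close>

definition tl_code :: "nat \<Rightarrow> nat" where
  "tl_code l = of_bool (0 < l) * snd (prod_decode (l - 1))"

definition hd_code :: "nat \<Rightarrow> nat" where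
  "hd_code l = of_bool (0 < l) * fst (prod_decode (l - 1))"

definition lookup :: "nat \<Rightarrow> nat \<Rightarrow> nat" where
  "lookup l i = hd_code ((tl_code ^^ i) l)"

text \<open>The bound \<open>l\<close> is large enough because a list is never longer than its code.
  The positivity test keeps the default value of \<open>hd_code\<close> at the empty list from
  counting as a member.\<close>

definition mem_code :: "nat \<Rightarrow> nat \<Rightarrow> bool" where
  "mem_code x l \<longleftrightarrow> (\<exists>i<l. 0 < (tl_code ^^ i) l \<and> hd_code ((tl_code ^^ i) l) = x)"

lemma tl_code_funpow: "(tl_code ^^ i) (list_encode xs) = list_encode (drop i xs)"
proof (induction i arbitrary: xs)
  case (Suc i)
  have "tl_code (list_encode xs) = list_encode (tl xs)"
    by (cases xs) (auto simp: tl_code_def)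
  then show ?case by (simp add: Suc funpow_Suc_right drop_Suc del: funpow.simps)
qed simp

lemma hd_code_list_encode: "hd_code (list_encode (x # xs)) = x"
  by (simp add: hd_code_def)

lemma lookup_list_encode:
  "lookup (list_encode xs) i = (if i < length xs then xs ! i else 0)"
  by (cases "drop i xs")
    (auto simp: lookup_def tl_code_funpow hd_code_def nth_via_drop)

lemma less_list_encode: "x \<in> set xs \<Longrightarrow> x < list_encode xs"
proof (induction xs)
  case (Cons y ys)
  then show ?case
    using le_prod_encode_1[of y "list_encode ys"] le_prod_encode_2[of "list_encode ys" y] by auto
qed simp

lemma length_le_list_encode: "length xs \<le> list_encode xs"
proof (induction xs)
  case (Cons y ys)
  then show ?case using le_prod_encode_2[of "list_encode ys" y] by simp
qed simp

lemma mem_code_list_encode: "mem_code x (list_encode xs) \<longleftrightarrow> x \<in> set xs"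
proof
  assume "mem_code x (list_encode xs)"
  then obtain i where i: "0 < list_encode (drop i xs)" "hd_code (list_encode (drop i xs)) = x"
    by (auto simp: mem_code_def tl_code_funpow)
  then have "x \<in> set (drop i xs)"
    by (cases "drop i xs") (auto simp: hd_code_list_encode simp del: list_encode.simps(2))
  then show "x \<in> set xs" by (rule in_set_dropD)
next
  assume "x \<in> set xs"
  then obtain i where "i < length xs" "xs ! i = x" by (auto simp: in_set_conv_nth)
  then show "mem_code x (list_encode xs)"
    using length_le_list_encode[of xs] unfolding mem_code_def tl_code_funpow
    by (intro exI[of _ i]) (auto simp: Cons_nth_drop_Suc[symmetric] hd_code_def)
qed

text \<open>The function \<open>f\<close> is arbitrary, computable or not: finitely many of its
  values fit into one number, so that a run or a congruence that merely exists becomes something to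
  search for.\<close>

lemma lookup_table: "\<exists>t. \<forall>i<n. lookup t i = f i"
  by (rule exI[of _ "list_encode (map f [0..<n])"]) (simp add: lookup_list_encode)

lemma lookup_table_finite:
  assumes "finite X"
  shows "\<exists>t. \<forall>i\<in>X. lookup t i = f i"
proof -
  obtain n where "\<forall>i\<in>X. i < n" using finite_nat_set_iff_bounded[THEN iffD1, OF assms] ..
  moreover obtain t where "\<forall>i<n. lookup t i = f i" using lookup_table ..
  ultimately show ?thesis by auto
qed

lemma computable_tl_code_funpow:
  assumes "computable F" "computable G"
  shows "computable (\<lambda>xs. (tl_code ^^ F xs) (G xs))"
proof -
  have "computable (\<lambda>xs. rec_nat (G xs) (\<lambda>i r. tl_code r) (F xs))"
    unfolding tl_code_def
    by (intro computable_rec_nat computable_mult computable_of_bool decidable_less computable_diff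
        computable_snd_decode computable_intros assms)
  moreover have "rec_nat a (\<lambda>i r. tl_code r) b = (tl_code ^^ b) a" for a b by (induction b) auto
  ultimately show ?thesis by simp
qed

lemma computable_hd_code:
  assumes "computable F"
  shows "computable (\<lambda>xs. hd_code (F xs))"
  unfolding hd_code_def
  by (intro computable_intros computable_of_bool computable_fst_decode assms)

lemma computable_lookup:
  assumes "computable F" "computable G"
  shows "computable (\<lambda>xs. lookup (F xs) (G xs))"
  unfolding lookup_def by (intro computable_hd_code computable_tl_code_funpow assms)

lemma decidable_mem_code:
  assumes "computable F" "computable G"
  shows "decidable (\<lambda>xs. mem_code (F xs) (G xs))"
proof -
  have "computable (\<lambda>xs. of_bool (mem_code (hd xs) (hd (tl xs))))"
    unfolding mem_code_def
    by (intro computable_of_bool computable_intros computable_hd_code computable_tl_code_funpow)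
  from computable_comp2[OF this assms] show ?thesis by (simp add: decidable_def)
qed

text \<open>Post's theorem with a promise: one minimisation finds the least witness of either kind,
  and its kind is the answer. The search has to terminate only for those \<open>c\<close> that
  satisfy the promise.\<close>

lemma decide_by_search:
  assumes Q: "decidable (\<lambda>xs. Q (hd (tl xs)) (hd xs))" and R: "decidable (\<lambda>xs. R (hd (tl xs)) (hd xs))"
  shows "\<exists>f. \<forall>c b. (\<exists>w. Q c w \<or> R c w) \<and> (\<forall>w. Q c w \<longrightarrow> b) \<and> (\<forall>w. R c w \<longrightarrow> \<not> b)
           \<longrightarrow> eval f [c] (of_bool b)"
proof -
  \<comment> \<open>\<open>Mu\<close> stops at the value 0, hence the negation.\<close>
  have "decidable (\<lambda>xs. \<not> (Q (hd (tl xs)) (hd xs) \<or> R (hd (tl xs)) (hd xs)))"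
    by (intro decidable_not decidable_disj Q R)
  then obtain n1 where n1: "\<And>m. m \<ge> n1 \<Longrightarrow> \<exists>f. \<forall>xs. length xs = m \<longrightarrow>
      eval f xs (of_bool (\<not> (Q (hd (tl xs)) (hd xs) \<or> R (hd (tl xs)) (hd xs))))"
    unfolding decidable_def computable_def by blast
  obtain n2 where n2: "\<And>m. m \<ge> n2 \<Longrightarrow> \<exists>f. \<forall>xs. length xs = m \<longrightarrow>
      eval f xs (of_bool (Q (hd (tl xs)) (hd xs)))"
    using Q unfolding decidable_def computable_def by blast
  define m where "m = n1 + n2"
  obtain g where g: "\<And>xs. length xs = m + 2 \<Longrightarrow>
      eval g xs (of_bool (\<not> (Q (hd (tl xs)) (hd xs) \<or> R (hd (tl xs)) (hd xs))))"
    using n1[of "m + 2"] by (auto simp: m_def)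
  obtain r where r: "\<And>xs. length xs = m + 2 \<Longrightarrow> eval r xs (of_bool (Q (hd (tl xs)) (hd xs)))"
    using n2[of "m + 2"] by (auto simp: m_def)
  \<comment> \<open>The input has length one, but \<open>g\<close> and \<open>r\<close> work at
    arity \<open>m + 2\<close>; \<open>m\<close> zeros and the number searched for make up the
    difference.\<close>
  define pad where "pad = Proj 0 # replicate m Zero"
  define f where "f = Comp r (Comp (Mu g) pad # pad)"
  have "eval f [c] (of_bool b)"
    if ex: "\<exists>w. Q c w \<or> R c w" and Qb: "\<And>w. Q c w \<Longrightarrow> b" and Rb: "\<And>w. R c w \<Longrightarrow> \<not> b" for c b
  proof -
    define ys where "ys = c # replicate m 0"
    have ys: "length ys = m + 1" "hd ys = c" by (simp_all add: ys_def)
    have pad: "\<forall>k<length pad. eval (pad ! k) [c] (ys ! k)"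
      using eval.intros(3)[of 0 "[c]"]
      by (auto simp: pad_def ys_def nth_Cons' intro: eval.intros)
    define w where "w = (LEAST w. Q c w \<or> R c w)"
    have w: "Q c w \<or> R c w" unfolding w_def using ex by (rule LeastI_ex)
    have g': "eval g (v # ys) (of_bool (\<not> (Q c v \<or> R c v)))" for v
      using g[of "v # ys"] ys by simp
    have "eval (Mu g) ys w"
    proof (rule eval.intros(7))
      show "eval g (w # ys) 0" using g'[of w] w by simp
      show "\<forall>v<w. \<exists>y. eval g (v # ys) (Suc y)"
      proof (intro allI impI)
        fix v assume "v < w"
        then have "\<not> (Q c v \<or> R c v)" unfolding w_def by (rule not_less_Least)
        with g'[of v] show "\<exists>y. eval g (v # ys) (Suc y)" by auto
      qed
    qed
    then have "eval (Comp (Mu g) pad) [c] w"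
      using pad by (intro eval.intros(4)[of ys]) (auto simp: pad_def ys)
    moreover have "eval r (w # ys) (of_bool (Q c w))"
      using r[of "w # ys"] ys by simp
    ultimately have "eval f [c] (of_bool (Q c w))"
      unfolding f_def using pad
      by (intro eval.intros(4)[of "w # ys"]) (auto simp: less_Suc_eq_0_disj pad_def[THEN arg_cong[of _ _ length]] ys)
    moreover have "Q c w = b" using w Qb Rb by blast
    ultimately show ?thesis by simp
  qed
  then show ?thesis by blast
qed

section \<open>Regular slices of rational sets\<close>

definition residual :: "'a list set \<Rightarrow> 'a list \<Rightarrow> 'a list set" where
  "residual L u = {v. u @ v \<in> L}"

text \<open>The Myhill-Nerode criterion. With it a closure property only requires that residuals of
  the new language be determined by finitely many data about residuals of the old ones.\<close>

definition regular :: "'a list set \<Rightarrow> bool" where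
  "regular L \<longleftrightarrow> finite (range (residual L))"

definition conc :: "'a list set \<Rightarrow> 'a list set \<Rightarrow> 'a list set" where
  "conc A B = {x @ y | x y. x \<in> A \<and> y \<in> B}"

inductive_set word_star :: "'a list set \<Rightarrow> 'a list set" for A where
  Nil: "[] \<in> word_star A"
| append: "a \<in> A \<Longrightarrow> x \<in> word_star A \<Longrightarrow> a @ x \<in> word_star A"

lemma word_star_append: "x \<in> word_star A \<Longrightarrow> y \<in> word_star A \<Longrightarrow> x @ y \<in> word_star A"
  by (induction rule: word_star.induct) (auto intro: word_star.intros)

lemma regular_finite:
  assumes "finite A"
  shows "regular A"
proof -
  have "residual A u \<subseteq> (\<Union>x\<in>A. (\<lambda>i. drop i x) ` {..length x})" for u
  proof
    fix v assume "v \<in> residual A u"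
    then have "u @ v \<in> A" by (simp add: residual_def)
    moreover have "v \<in> (\<lambda>i. drop i (u @ v)) ` {..length (u @ v)}"
      by (rule image_eqI[of _ _ "length u"]) auto
    ultimately show "v \<in> (\<Union>x\<in>A. (\<lambda>i. drop i x) ` {..length x})" by blast
  qed
  then have "range (residual A) \<subseteq> Pow (\<Union>x\<in>A. (\<lambda>i. drop i x) ` {..length x})" by auto
  then show ?thesis
    unfolding regular_def using assms by (auto intro: finite_subset)
qed

lemma regular_Un:
  assumes "regular A" "regular B"
  shows "regular (A \<union> B)"
proof -
  have "range (residual (A \<union> B)) \<subseteq> (\<lambda>(X, Y). X \<union> Y) ` (range (residual A) \<times> range (residual B))"
  proof
    fix X assume "X \<in> range (residual (A \<union> B))"
    then obtain u where "X = residual A u \<union> residual B u" by (auto simp: residual_def)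
    then show "X \<in> (\<lambda>(X, Y). X \<union> Y) ` (range (residual A) \<times> range (residual B))" by auto
  qed
  from finite_subset[OF this] show ?thesis
    using assms by (simp add: regular_def)
qed

text \<open>Either \<open>u\<close> ends inside the factor from \<open>A\<close>, or that factor is
  a prefix of \<open>u\<close>. The second part is a union of residuals of \<open>B\<close>, so
  finitely many sets arise in all.\<close>

lemma residual_conc:
  "residual (conc A B) u = conc (residual A u) B \<union> \<Union>{residual B u2 | u1 u2. u = u1 @ u2 \<and> u1 \<in> A}"
    (is "_ = ?R")
proof (intro set_eqI iffI)
  fix v assume "v \<in> residual (conc A B) u"
  then obtain x y where xy: "u @ v = x @ y" "x \<in> A" "y \<in> B"
    by (auto simp: residual_def conc_def)
  then consider t where "x = u @ t" "v = t @ y" | t where "u = x @ t" "y = t @ v"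
    by (auto simp: append_eq_append_conv2)
  then show "v \<in> ?R"
  proof cases
    case 1
    with xy have "v \<in> conc (residual A u) B" by (auto simp: residual_def conc_def)
    then show ?thesis by blast
  next
    case 2
    with xy have "v \<in> residual B t" by (auto simp: residual_def)
    with 2 xy show ?thesis by blast
  qed
next
  fix v assume "v \<in> ?R"
  then consider "v \<in> conc (residual A u) B" | u1 u2 where "u = u1 @ u2" "u1 \<in> A" "v \<in> residual B u2"
    by blast
  then show "v \<in> residual (conc A B) u"
  proof cases
    case 1
    then obtain t y where "v = t @ y" "u @ t \<in> A" "y \<in> B" by (auto simp: residual_def conc_def)
    then show ?thesis unfolding residual_def conc_def by (metis (mono_tags, lifting) append.assoc mem_Collect_eq)
  next
    case 2
    then show ?thesis by (auto simp: residual_def conc_def)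
  qed
qed

lemma regular_conc:
  assumes "regular A" "regular B"
  shows "regular (conc A B)"
proof -
  have "range (residual (conc A B)) \<subseteq>
      (\<lambda>(X, T). conc X B \<union> \<Union>T) ` (range (residual A) \<times> Pow (range (residual B)))"
  proof
    fix X assume "X \<in> range (residual (conc A B))"
    then obtain u where "X = conc (residual A u) B \<union>
        \<Union>{residual B u2 | u1 u2. u = u1 @ u2 \<and> u1 \<in> A}" by (auto simp: residual_conc)
    then show "X \<in> (\<lambda>(X, T). conc X B \<union> \<Union>T) ` (range (residual A) \<times> Pow (range (residual B)))"
      by (intro image_eqI[of _ _ "(residual A u, {residual B u2 | u1 u2. u = u1 @ u2 \<and> u1 \<in> A})"]) auto
  qed
  from finite_subset[OF this] show ?thesis
    using assms by (simp add: regular_def)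
qed

text \<open>Cut at the factor in which \<open>u\<close> ends; \<open>u2\<close> is the part of that
  factor lying in \<open>u\<close>. If \<open>u\<close> and \<open>v\<close> were both empty, there
  might be no such factor.\<close>

lemma word_star_split:
  assumes "u @ v \<in> word_star A" "u \<noteq> []"
  shows "\<exists>u1 u2. u = u1 @ u2 \<and> u1 \<in> word_star A \<and> v \<in> conc (residual A u2) (word_star A)"
  using assms
proof (induction "u @ v" arbitrary: u v rule: word_star.induct)
  case Nil
  then show ?case by simp
next
  case (append a x)
  \<comment> \<open>A factor that ends exactly where \<open>u\<close> ends goes to the first case,
    so in the second case \<open>t\<close> is nonempty and the induction hypothesis applies.\<close>
  from append.hyps(4) consider t where "a = u @ t" "v = t @ x" | t where "u = a @ t" "x = t @ v" "t \<noteq> []"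
    by (cases "length a \<le> length u \<and> a \<noteq> u") (auto simp: append_eq_append_conv2)
  then show ?case
  proof cases
    case 1
    then show ?thesis using append.hyps
      by (intro exI[of _ "[]"] exI[of _ u])
        (auto simp: conc_def residual_def intro: word_star.intros)
  next
    case 2
    then obtain u1 u2 where "t = u1 @ u2" "u1 \<in> word_star A" "v \<in> conc (residual A u2) (word_star A)"
      using append.hyps(3) by blast
    with 2 append.hyps show ?thesis
      by (intro exI[of _ "a @ u1"] exI[of _ u2]) (auto intro: word_star.intros)
  qed
qed

lemma residual_word_star:
  assumes "u \<noteq> []"
  shows "residual (word_star A) u =
    \<Union>{conc (residual A u2) (word_star A) | u1 u2. u = u1 @ u2 \<and> u1 \<in> word_star A}" (is "_ = ?R")
proof
  show "residual (word_star A) u \<subseteq> ?R"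
    using word_star_split[OF _ assms] by (fastforce simp: residual_def)
next
  have "u1 @ u2 @ y @ z \<in> word_star A"
    if "u1 \<in> word_star A" "u2 @ y \<in> A" "z \<in> word_star A" for u1 u2 y z
    using word_star_append[OF that(1) word_star.append[OF that(2,3)]] by simp
  then show "?R \<subseteq> residual (word_star A) u"
    by (auto simp: residual_def conc_def)
qed

lemma regular_word_star:
  assumes "regular A"
  shows "regular (word_star A)"
proof -
  have "residual (word_star A) u \<in> insert (word_star A)
      ((\<lambda>T. \<Union>X\<in>T. conc X (word_star A)) ` Pow (range (residual A)))" for u
  proof (cases "u = []")
    case True
    then show ?thesis by (simp add: residual_def)
  next
    case False
    have "residual (word_star A) u =
        (\<Union>X\<in>{residual A u2 | u1 u2. u = u1 @ u2 \<and> u1 \<in> word_star A}. conc X (word_star A))"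
      unfolding residual_word_star[OF False] by blast
    then show ?thesis by blast
  qed
  then have "range (residual (word_star A)) \<subseteq> insert (word_star A)
      ((\<lambda>T. \<Union>X\<in>T. conc X (word_star A)) ` Pow (range (residual A)))" by blast
  from finite_subset[OF this] show ?thesis
    using assms by (simp add: regular_def)
qed

section \<open>Slices of rational sets of channel contents\<close>

definition slice :: "'e \<Rightarrow> ('e \<Rightarrow> 'm list) set \<Rightarrow> 'm list set" where
  "slice k A = {x. empty_chan(k := x) \<in> A}"

text \<open>Concatenation cancels nothing, so a product is empty on a channel only if both factors
  are. Hence slicing commutes with product and star, although intersections of rational sets need
  not be rational in general.\<close>

lemma cmult_eq_singleton_iff:
  "cmult x y = empty_chan(k := z) \<longleftrightarrow>
     x = empty_chan(k := x k) \<and> y = empty_chan(k := y k) \<and> z = x k @ y k"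
  by (auto simp: cmult_def empty_chan_def fun_eq_iff)

lemma slice_setprod: "slice k (setprod A B) = conc (slice k A) (slice k B)"
proof (intro set_eqI iffI)
  fix z assume "z \<in> slice k (setprod A B)"
  then obtain x y where "x \<in> A" "y \<in> B" "cmult x y = empty_chan(k := z)"
    by (auto simp: slice_def setprod_def)
  then show "z \<in> conc (slice k A) (slice k B)"
    unfolding cmult_eq_singleton_iff conc_def slice_def by (metis (mono_tags, lifting) mem_Collect_eq)
next
  fix z assume "z \<in> conc (slice k A) (slice k B)"
  then obtain x y where "empty_chan(k := x) \<in> A" "empty_chan(k := y) \<in> B" "z = x @ y"
    by (auto simp: slice_def conc_def)
  moreover have "empty_chan(k := x @ y) = cmult (empty_chan(k := x)) (empty_chan(k := y))"
    by (auto simp: cmult_def empty_chan_def)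
  ultimately show "z \<in> slice k (setprod A B)"
    by (auto simp: slice_def setprod_def)
qed

lemma slice_kstar:
  fixes A :: "('e \<Rightarrow> 'm list) set"
  shows "slice k (kstar A) = word_star (slice k A)"
proof (intro set_eqI iffI)
  have "C = empty_chan(k := z) \<Longrightarrow> z \<in> word_star (slice k A)" if "C \<in> kstar A" for C z
    using that
  proof (induction arbitrary: z rule: kstar.induct)
    case unit
    then have "z = []" by (auto simp: empty_chan_def fun_eq_iff split: if_splits)
    then show ?case by (simp add: word_star.Nil)
  next
    case (mult a x)
    then have "a k \<in> slice k A" "z = a k @ x k" "x = empty_chan(k := x k)"
      unfolding cmult_eq_singleton_iff slice_def by auto
    with mult.IH[of "x k"] show ?case by (metis word_star.append)
  qed
  then show "z \<in> slice k (kstar A) \<Longrightarrow> z \<in> word_star (slice k A)" for z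
    by (auto simp: slice_def)
next
  fix z assume "z \<in> word_star (slice k A)"
  then show "z \<in> slice k (kstar A)"
  proof (induction rule: word_star.induct)
    case Nil
    have "empty_chan(k := []) = (empty_chan :: 'e \<Rightarrow> 'm list)" by (auto simp: empty_chan_def)
    then show ?case using kstar.unit[of A] unfolding slice_def by simp
  next
    case (append a x)
    then have "cmult (empty_chan(k := a)) (empty_chan(k := x)) \<in> kstar A"
      unfolding slice_def by (intro kstar.mult) simp_all
    moreover have "cmult (empty_chan(k := a)) (empty_chan(k := x)) = empty_chan(k := a @ x)"
      by (simp add: cmult_eq_singleton_iff)
    ultimately show ?case unfolding slice_def by simp
  qed
qed

lemma regular_slice:
  assumes "A \<in> rational_sets Mon"
  shows "regular (slice k A)"
  using assms
proof (induction rule: rational_sets.induct)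
  case (fin A)
  have "inj (\<lambda>x. empty_chan(k := x))"
    by (rule injI) (metis fun_upd_same)
  then have "finite (slice k A)"
    using fin finite_vimageI[of A "\<lambda>x. empty_chan(k := x)"] by (simp add: slice_def vimage_def)
  then show ?case by (rule regular_finite)
next
  case (union A B)
  moreover have "slice k (A \<union> B) = slice k A \<union> slice k B" by (auto simp: slice_def)
  ultimately show ?case by (simp add: regular_Un)
next
  case (prod A B)
  then show ?case by (simp add: slice_setprod regular_conc)
next
  case (star A)
  then show ?case by (simp add: slice_kstar regular_word_star)
qed

section \<open>Syntactic congruences\<close>

definition contexts :: "'a list set \<Rightarrow> 'a list \<Rightarrow> ('a list \<times> 'a list) set" where
  "contexts L x = {(u, v). u @ x @ v \<in> L}"

text \<open>The syntactic monoid is finite: a word \<open>x\<close> acts on the residuals by sending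
  that of \<open>u\<close> to that of \<open>u @ x\<close>. The graph \<open>G x\<close> of this map
  determines the contexts of \<open>x\<close>, and a finite set has only finitely many such
  graphs.\<close>

lemma finite_contexts:
  assumes "regular L"
  shows "finite (range (contexts L))"
proof -
  define G where "G x = (\<lambda>u. (residual L u, residual L (u @ x))) ` UNIV" for x
  define H where "H g = {(u, v). \<exists>s. (residual L u, s) \<in> g \<and> v \<in> s}" for g :: "('a list set \<times> 'a list set) set"
  have "contexts L x = H (G x)" for x
  proof -
    have "residual L (u @ x) = residual L (u' @ x)" if "residual L u = residual L u'" for u u'
      using that by (auto simp: residual_def set_eq_iff)
    then have "(residual L u, s) \<in> G x \<longleftrightarrow> s = residual L (u @ x)" for u s
      unfolding G_def by blast
    then have "H (G x) = {(u, v). v \<in> residual L (u @ x)}"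
      unfolding H_def by simp
    then show ?thesis by (simp add: contexts_def residual_def)
  qed
  then have "range (contexts L) \<subseteq> H ` Pow (range (residual L) \<times> range (residual L))"
    by (auto simp: G_def)
  from finite_subset[OF this] show ?thesis
    using assms by (simp add: regular_def)
qed

text \<open>The common refinement of the syntactic congruences of all \<open>L i\<close>, with
  numbered classes. The numbers fill an initial segment because a certificate quantifies over
  everything below \<open>N\<close>, and each such number must be the class of some word.\<close>

lemma finite_congruence:
  assumes I: "finite I" and L: "\<And>i. i \<in> I \<Longrightarrow> regular (L i)"
  shows "\<exists>(N :: nat) \<nu>. range \<nu> = {..<N} \<and>
           (\<forall>x y u v. \<nu> x = \<nu> y \<longrightarrow> \<nu> (u @ x @ v) = \<nu> (u @ y @ v)) \<and>
           (\<forall>i\<in>I. \<forall>x y. \<nu> x = \<nu> y \<longrightarrow> x \<in> L i \<longrightarrow> y \<in> L i)"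
proof -
  define K where "K x = (\<lambda>i\<in>I. contexts (L i) x)" for x
  have "range K \<subseteq> (PiE I (\<lambda>i. range (contexts (L i))))" by (auto simp: K_def)
  then have "finite (range K)"
    by (rule finite_subset) (intro finite_PiE I finite_contexts L)
  then obtain h where h: "bij_betw h (range K) {0..<card (range K)}"
    using ex_bij_betw_finite_nat by blast
  define \<nu> where "\<nu> x = h (K x)" for x
  have K: "K x = K y \<longleftrightarrow> (\<forall>i\<in>I. \<forall>u v. u @ x @ v \<in> L i \<longleftrightarrow> u @ y @ v \<in> L i)" for x y
    by (auto simp: K_def restrict_def fun_eq_iff contexts_def set_eq_iff)
  have \<nu>: "\<nu> x = \<nu> y \<longleftrightarrow> K x = K y" for x y
    using bij_betw_imp_inj_on[OF h] by (auto simp: \<nu>_def inj_on_def)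
  have "K (u @ x @ v) = K (u @ y @ v)" if "K x = K y" for x y u v
    unfolding K
  proof (intro ballI allI)
    fix i u' v' assume "i \<in> I"
    with that have "(u' @ u) @ x @ v @ v' \<in> L i \<longleftrightarrow> (u' @ u) @ y @ v @ v' \<in> L i"
      unfolding K by blast
    then show "u' @ (u @ x @ v) @ v' \<in> L i \<longleftrightarrow> u' @ (u @ y @ v) @ v' \<in> L i" by simp
  qed
  moreover have "x \<in> L i \<Longrightarrow> y \<in> L i" if "K x = K y" "i \<in> I" for x y i
    using that unfolding K by (metis append_Nil append_Nil2)
  moreover have "range \<nu> = {..<card (range K)}"
    using bij_betw_imp_surj_on[OF h] by (auto simp: \<nu>_def image_image)
  ultimately show ?thesis
    unfolding \<nu>[symmetric] by blast
qed

section \<open>Witnesses of stability and certificates of instability\<close>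

text \<open>Positions in the instance code: 0 and 1 hold the messages, 4 and 5 the initial states, 6
  and 7 the transitions, 8 and 9 the state in question. The codes of actions are even for sends and
  odd for receives.\<close>

definition msg_code :: "nat \<Rightarrow> nat \<Rightarrow> nat \<Rightarrow> bool" where
  "msg_code c e b \<longleftrightarrow> mem_code b (lookup c e)"

definition send_code :: "nat \<Rightarrow> nat \<Rightarrow> nat \<Rightarrow> nat \<Rightarrow> bool" where
  "send_code c p b p' \<longleftrightarrow> mem_code (pair p (pair (2 * b) p')) (lookup c 6)"

definition recv_code :: "nat \<Rightarrow> nat \<Rightarrow> nat \<Rightarrow> nat \<Rightarrow> bool" where
  "recv_code c q b q' \<longleftrightarrow> mem_code (pair q (pair (2 * b + 1) q')) (lookup c 7)"

text \<open>A certificate of instability. The numbers below \<open>N\<close> are the classes of a finite congruence on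
  words, \<open>e\<close> is the class of the empty word, and \<open>l\<close>, \<open>r\<close> add a letter on the left and on the right;
  the commutation law makes the class of a word well defined. \<open>D k p q z\<close> asserts that control state
  \<open>(p, q)\<close> may occur with a word of class \<open>z\<close> in channel \<open>k\<close> and the other channel empty.\<close>

definition separator ::
    "nat \<Rightarrow> nat \<Rightarrow> nat \<Rightarrow> (nat \<Rightarrow> nat \<Rightarrow> nat) \<Rightarrow> (nat \<Rightarrow> nat \<Rightarrow> nat) \<Rightarrow>
     (nat \<Rightarrow> nat \<Rightarrow> nat \<Rightarrow> nat \<Rightarrow> bool) \<Rightarrow> bool" where
  "separator c N e l r D \<longleftrightarrow>
     e < N \<and>
     (\<forall>a\<le>c. l a e = r a e) \<and>
     (\<forall>a\<le>c. \<forall>z<N. l a z < N) \<and>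
     (\<forall>a\<le>c. \<forall>b\<le>c. \<forall>z<N. l b (r a z) = r a (l b z)) \<and>
     D 0 (lookup c 4) (lookup c 5) e \<and>
     \<not> D 0 (lookup c 8) (lookup c 9) e \<and>
     (\<forall>k<2. \<forall>p\<le>c. \<forall>q\<le>c. D k p q e \<longrightarrow> D (1 - k) p q e) \<and>
     (\<forall>k<2. \<forall>p\<le>c. \<forall>q\<le>c. \<forall>z<N. \<forall>a\<le>c. \<forall>p'\<le>c.
        D k p q z \<longrightarrow> msg_code c k a \<longrightarrow> send_code c p a p' \<longrightarrow> D k p' q (r a z)) \<and>
     (\<forall>k<2. \<forall>p\<le>c. \<forall>q\<le>c. \<forall>z<N. \<forall>a\<le>c. \<forall>q'\<le>c.
        D k p q (l a z) \<longrightarrow> msg_code c k a \<longrightarrow> recv_code c q a q' \<longrightarrow> D k p q' z) \<and>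
     (\<forall>k<2. \<forall>p\<le>c. \<forall>q\<le>c. \<forall>z<N. \<forall>a\<le>c. \<forall>p'\<le>c. \<forall>q'\<le>c.
        D k p q z \<longrightarrow> msg_code c (1 - k) a \<longrightarrow> send_code c p a p' \<longrightarrow> recv_code c q a q' \<longrightarrow>
        D k p' q' z)"

definition unstable_cert :: "nat \<Rightarrow> nat \<Rightarrow> bool" where
  "unstable_cert c w \<longleftrightarrow>
     separator c (lookup w 0) (lookup w 1)
       (\<lambda>a z. lookup (lookup w 2) (pair a z)) (\<lambda>a z. lookup (lookup w 3) (pair a z))
       (\<lambda>k p q z. 0 < lookup (lookup w 4) (pair k (pair p (pair q z))))"

lemma decidable_unstable_cert: "decidable (\<lambda>xs. unstable_cert (hd (tl xs)) (hd xs))"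
  unfolding unstable_cert_def separator_def msg_code_def send_code_def recv_code_def
  by (intro computable_intros computable_lookup computable_pair decidable_mem_code)

text \<open>A configuration is coded as \<open>[p, q, x\<^sub>0, x\<^sub>1, W\<^sub>0, W\<^sub>1]\<close>, where \<open>x\<^sub>e\<close> is the content of channel \<open>e\<close>
  read as a numeral in base \<open>Suc c\<close>, first message least significant, and \<open>W\<^sub>e\<close> is the base to the power
  of its length; sending and receiving then become multiplication and addition.\<close>

definition step_code :: "nat \<Rightarrow> nat \<Rightarrow> nat \<Rightarrow> bool" where
  "step_code c u v \<longleftrightarrow> (\<exists>e<2. \<exists>b\<le>c. msg_code c e b \<and>
     lookup v (2 + (1 - e)) = lookup u (2 + (1 - e)) \<and> lookup v (4 + (1 - e)) = lookup u (4 + (1 - e)) \<and>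
     (send_code c (lookup u 0) b (lookup v 0) \<and> lookup v 1 = lookup u 1 \<and>
        lookup v (2 + e) = lookup u (2 + e) + b * lookup u (4 + e) \<and>
        lookup v (4 + e) = Suc c * lookup u (4 + e) \<or>
      recv_code c (lookup u 1) b (lookup v 1) \<and> lookup v 0 = lookup u 0 \<and>
        lookup u (2 + e) = b + Suc c * lookup v (2 + e) \<and>
        lookup u (4 + e) = Suc c * lookup v (4 + e)))"

text \<open>Entry 0 of \<open>w\<close> is the length of the run and entry 1 the list of its
  configurations. The tail \<open>0, 0, 1, 1\<close> stands for two empty channels: numeral 0 and
  base to the power 0.\<close>

definition stable_witness :: "nat \<Rightarrow> nat \<Rightarrow> bool" where
  "stable_witness c w \<longleftrightarrow>
     lookup (lookup w 1) 0 = list_encode [lookup c 4, lookup c 5, 0, 0, 1, 1] \<and>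
     lookup (lookup w 1) (lookup w 0) = list_encode [lookup c 8, lookup c 9, 0, 0, 1, 1] \<and>
     (\<forall>i<lookup w 0. step_code c (lookup (lookup w 1) i) (lookup (lookup w 1) (Suc i)))"

lemma decidable_stable_witness: "decidable (\<lambda>xs. stable_witness (hd (tl xs)) (hd xs))"
  unfolding stable_witness_def step_code_def msg_code_def send_code_def recv_code_def
    list_encode.simps pair_def[symmetric]
  by (intro computable_intros computable_lookup computable_pair decidable_mem_code)

lemma stable_witness_iff:
  "(\<exists>w. stable_witness c w) \<longleftrightarrow>
     (step_code c)\<^sup>*\<^sup>* (list_encode [lookup c 4, lookup c 5, 0, 0, 1, 1])
       (list_encode [lookup c 8, lookup c 9, 0, 0, 1, 1])"
    (is "_ \<longleftrightarrow> (step_code c)\<^sup>*\<^sup>* ?u ?v")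
proof
  assume "\<exists>w. stable_witness c w"
  then obtain w where w: "stable_witness c w" ..
  have "(step_code c ^^ lookup w 0) ?u ?v"
    unfolding relpowp_fun_conv
    by (rule exI[of _ "lookup (lookup w 1)"]) (use w in \<open>simp add: stable_witness_def\<close>)
  then show "(step_code c)\<^sup>*\<^sup>* ?u ?v" by (rule relpowp_imp_rtranclp)
next
  assume "(step_code c)\<^sup>*\<^sup>* ?u ?v"
  then obtain n f where f: "f 0 = ?u" "f n = ?v" "\<And>i. i < n \<Longrightarrow> step_code c (f i) (f (Suc i))"
    unfolding rtranclp_power relpowp_fun_conv by blast
  obtain t where t: "\<And>i. i < Suc n \<Longrightarrow> lookup t i = f i"
    using lookup_table[of "Suc n" f] by blast
  have "stable_witness c (list_encode [n, t])"
    unfolding stable_witness_def using f t by (simp add: lookup_list_encode del: list_encode.simps)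
  then show "\<exists>w. stable_witness c w" ..
qed

section \<open>Reading a protocol from its code\<close>

lemma mem_enc_set: "finite A \<Longrightarrow> mem_code x (enc_set A) \<longleftrightarrow> x \<in> A"
  by (simp add: enc_set_def mem_code_list_encode)

lemma less_enc_set: "finite A \<Longrightarrow> x \<in> A \<Longrightarrow> x < enc_set A"
  unfolding enc_set_def by (rule less_list_encode) simp

lemma mem_enc_trans:
  assumes "finite T"
  shows "mem_code (pair p (pair (enc_act a) q)) (enc_trans T) \<longleftrightarrow> (p, a, q) \<in> T"
proof -
  have "enc_act a = enc_act a' \<Longrightarrow> a = a'" for a a'
    by (cases a; cases a') (auto, presburger+)
  then show ?thesis
    unfolding enc_trans_def pair_def using assms by (subst mem_enc_set) force+
qed

locale two_channel =
  fixes P :: "(bool, bool, nat, nat) cfsm" and S :: "bool \<Rightarrow> nat" and c :: nat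
  assumes wf: "wf_cfsm P" and graph: "two_parallel_graph P" and comp: "composite_state P S"
    and c_def: "c = encode_instance P S"
begin

lemma lookup_c:
  "lookup c 0 = enc_set (msgs P False)" "lookup c 1 = enc_set (msgs P True)"
  "lookup c 4 = init P False" "lookup c 5 = init P True"
  "lookup c 6 = enc_trans (trans P False)" "lookup c 7 = enc_trans (trans P True)"
  "lookup c 8 = S False" "lookup c 9 = S True"
  unfolding c_def encode_instance_def lookup_list_encode by simp_all

lemma finite_trans: "finite (trans P j)"
proof -
  have "finite (alphabet P j)"
  proof -
    have "alphabet P j \<subseteq> (Recv ` (\<Union>e. msgs P e)) \<union> (Send ` (\<Union>e. msgs P e))"
      by (auto simp: alphabet_def)
    moreover have "finite (\<Union>e. msgs P e)"
      using wf graph by (auto simp: wf_cfsm_def two_parallel_graph_def)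
    ultimately show ?thesis by (meson finite_UnI finite_imageI finite_subset)
  qed
  moreover have "finite (states P j)" "trans P j \<subseteq> states P j \<times> alphabet P j \<times> states P j"
    using wf graph by (auto simp: wf_cfsm_def two_parallel_graph_def)
  ultimately show ?thesis by (meson finite_SigmaI finite_subset)
qed

lemma finite_msgs: "finite (msgs P e)"
  using wf graph by (auto simp: wf_cfsm_def two_parallel_graph_def)

lemma finite_states: "finite (states P j)"
  using wf graph by (auto simp: wf_cfsm_def two_parallel_graph_def)

lemma msg_code_iff: "msg_code c (of_bool e) b \<longleftrightarrow> b \<in> msgs P e"
  unfolding msg_code_def using lookup_c(1,2) finite_msgs by (cases e) (simp_all add: mem_enc_set)

lemma send_code_iff: "send_code c p b p' \<longleftrightarrow> (p, Send b, p') \<in> trans P False"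
  using mem_enc_trans[OF finite_trans, of p "Send b" p' False]
  by (simp add: send_code_def lookup_c)

lemma recv_code_iff: "recv_code c q b q' \<longleftrightarrow> (q, Recv b, q') \<in> trans P True"
  using mem_enc_trans[OF finite_trans, of q "Recv b" q' True]
  by (simp add: recv_code_def lookup_c)

text \<open>A list code exceeds every member of the list, so the instance code itself can bound the
  quantifiers over messages and states.\<close>

lemma msg_bound: "b \<in> msgs P e \<Longrightarrow> b \<le> c"
proof -
  assume "b \<in> msgs P e"
  then have "b < enc_set (msgs P e)" by (rule less_enc_set[OF finite_msgs])
  also have "enc_set (msgs P e) < c"
    unfolding c_def encode_instance_def by (rule less_list_encode) (cases e; simp)
  finally show ?thesis by simp
qed

lemma state_bound: "p \<in> states P j \<Longrightarrow> p \<le> c"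
proof -
  assume "p \<in> states P j"
  then have "p < enc_set (states P j)" by (rule less_enc_set[OF finite_states])
  also have "enc_set (states P j) < c"
    unfolding c_def encode_instance_def by (rule less_list_encode) (cases j; simp)
  finally show ?thesis by simp
qed

lemma trans_states: "(p, a, p') \<in> trans P j \<Longrightarrow> p \<in> states P j \<and> p' \<in> states P j"
  using wf graph by (auto simp: wf_cfsm_def two_parallel_graph_def)

lemma init_states: "init P j \<in> states P j"
  using wf graph by (auto simp: wf_cfsm_def two_parallel_graph_def)

lemma step_send:
  "b \<in> msgs P e \<Longrightarrow> (T False, Send b, q) \<in> trans P False \<Longrightarrow>
     step P (T, C) (T(False := q), C(e := C e @ [b]))"
  using graph by (intro step.send) (auto simp: two_parallel_graph_def)

lemma step_recv:
  "b \<in> msgs P e \<Longrightarrow> (T True, Recv b, q) \<in> trans P True \<Longrightarrow> C e = b # x \<Longrightarrow>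
     step P (T, C) (T(True := q), C(e := x))"
  using graph by (intro step.recv) (auto simp: two_parallel_graph_def)

lemma step_cases:
  assumes "step P (T, C) (T', C')"
  obtains (Send) e b q where "b \<in> msgs P e" "(T False, Send b, q) \<in> trans P False"
      "T' = T(False := q)" "C' = C(e := C e @ [b])"
  | (Recv) e b q x where "b \<in> msgs P e" "(T True, Recv b, q) \<in> trans P True" "C e = b # x"
      "T' = T(True := q)" "C' = C(e := x)"
  using assms graph by cases (auto simp: two_parallel_graph_def)

end

section \<open>Correctness of stability witnesses\<close>

fun chan_val :: "nat \<Rightarrow> nat list \<Rightarrow> nat" where
  "chan_val B [] = 0"
| "chan_val B (b # x) = b + B * chan_val B x"

lemma chan_val_snoc: "chan_val B (x @ [b]) = chan_val B x + b * B ^ length x"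
  by (induction x) (simp_all add: algebra_simps)

text \<open>Channels are numbers in the codes and booleans in the protocol; \<open>of_bool\<close>
  translates, and \<open>1 - k\<close> becomes negation.\<close>

lemma ex_less_two_iff: "(\<exists>k<2. Q k) \<longleftrightarrow> (\<exists>e. Q (of_bool e :: nat))"
proof
  assume "\<exists>k<2. Q k"
  then obtain k where "Q k" "k = 0 \<or> k = 1" by (auto simp: less_2_cases_iff)
  then show "\<exists>e. Q (of_bool e)" by (metis of_bool_eq)
next
  assume "\<exists>e. Q (of_bool e)"
  then obtain e where "Q (of_bool e)" ..
  then show "\<exists>k<2. Q k" by (intro exI[of _ "of_bool e"]) auto
qed

lemma all_less_two_iff: "(\<forall>k<2. Q k) \<longleftrightarrow> (\<forall>e. Q (of_bool e :: nat))"
  using ex_less_two_iff[of "\<lambda>k. \<not> Q k"] by blast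

lemma one_minus_of_bool: "1 - of_bool e = (of_bool (\<not> e) :: nat)"
  by simp

definition content_at :: "nat \<Rightarrow> bool \<Rightarrow> nat" where
  "content_at u e = lookup u (2 + of_bool e)"

definition weight_at :: "nat \<Rightarrow> bool \<Rightarrow> nat" where
  "weight_at u e = lookup u (4 + of_bool e)"

context two_channel
begin

text \<open>A relation rather than equality with \<open>config_code\<close>, because
  \<open>step_code\<close> constrains only the first six entries: a witness may contain numbers that
  code longer lists.\<close>

definition represents :: "nat \<Rightarrow> (bool \<Rightarrow> nat) \<Rightarrow> (bool \<Rightarrow> nat list) \<Rightarrow> bool" where
  "represents u T C \<longleftrightarrow> lookup u 0 = T False \<and> lookup u 1 = T True \<and>
     (\<forall>e. content_at u e = chan_val (Suc c) (C e) \<and> weight_at u e = Suc c ^ length (C e) \<and>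
          set (C e) \<subseteq> msgs P e)"

definition config_code :: "(bool \<Rightarrow> nat) \<Rightarrow> (bool \<Rightarrow> nat list) \<Rightarrow> nat" where
  "config_code T C = list_encode [T False, T True, chan_val (Suc c) (C False), chan_val (Suc c) (C True),
     Suc c ^ length (C False), Suc c ^ length (C True)]"

lemma c_pos: "0 < c"
  by (simp add: c_def encode_instance_def)

lemma represents_config_code:
  assumes "\<And>e. set (C e) \<subseteq> msgs P e"
  shows "represents (config_code T C) T C"
proof -
  have "content_at (config_code T C) e = chan_val (Suc c) (C e)" for e
    unfolding content_at_def config_code_def lookup_list_encode by (cases e) simp_all
  moreover have "weight_at (config_code T C) e = Suc c ^ length (C e)" for e
    unfolding weight_at_def config_code_def lookup_list_encode by (cases e) simp_all
  moreover have "lookup (config_code T C) 0 = T False" "lookup (config_code T C) 1 = T True"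
    unfolding config_code_def lookup_list_encode by simp_all
  ultimately show ?thesis using assms by (simp add: represents_def)
qed

lemma config_code_empty: "config_code T empty_chan = list_encode [T False, T True, 0, 0, 1, 1]"
  by (simp add: config_code_def empty_chan_def)

text \<open>The weights decide. Message 0 is a legal digit, so numeral 0 does not force a channel to
  be empty, whereas a power of a base above 1 equals 1 only for length 0.\<close>

lemma represents_empty:
  assumes "represents (config_code T empty_chan) T' C"
  shows "T' = T" "C = empty_chan"
proof -
  have R: "represents (config_code T empty_chan) T empty_chan"
    by (rule represents_config_code) (simp add: empty_chan_def)
  have "T' e = T e" for e
    using assms R by (cases e) (simp_all add: represents_def)
  then show "T' = T" by auto
  have "Suc c ^ length (C e) = 1" for e
    using assms R by (auto simp: represents_def empty_chan_def)
  then show "C = empty_chan"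
    using c_pos by (auto simp: empty_chan_def)
qed

lemma step_code_iff:
  "step_code c u v \<longleftrightarrow> (\<exists>e. \<exists>b\<in>msgs P e.
     content_at v (\<not> e) = content_at u (\<not> e) \<and> weight_at v (\<not> e) = weight_at u (\<not> e) \<and>
     ((lookup u 0, Send b, lookup v 0) \<in> trans P False \<and> lookup v 1 = lookup u 1 \<and>
        content_at v e = content_at u e + b * weight_at u e \<and>
        weight_at v e = Suc c * weight_at u e \<or>
      (lookup u 1, Recv b, lookup v 1) \<in> trans P True \<and> lookup v 0 = lookup u 0 \<and>
        content_at u e = b + Suc c * content_at v e \<and>
        weight_at u e = Suc c * weight_at v e))"
  unfolding step_code_def ex_less_two_iff msg_code_iff send_code_iff recv_code_iff
    one_minus_of_bool content_at_def[symmetric] weight_at_def[symmetric]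
  using msg_bound by blast

lemma step_imp_step_code:
  assumes "represents u T C" "represents v T' C'" "step P (T, C) (T', C')"
  shows "step_code c u v"
  using assms(3)
proof (cases rule: step_cases)
  case (Send e b q)
  then show ?thesis
    unfolding step_code_iff using assms(1,2)
    by (intro exI[of _ e] bexI[of _ b] conjI disjI1)
      (auto simp: represents_def chan_val_snoc)
next
  case (Recv e b q x)
  then show ?thesis
    unfolding step_code_iff using assms(1,2)
    by (intro exI[of _ e] bexI[of _ b] conjI disjI2)
      (auto simp: represents_def)
qed

lemma step_code_imp_step:
  assumes u: "represents u T C" and "step_code c u v"
  shows "\<exists>T' C'. step P (T, C) (T', C') \<and> represents v T' C'"
proof -
  obtain e b where b: "b \<in> msgs P e" and
    same: "content_at v (\<not> e) = content_at u (\<not> e)" "weight_at v (\<not> e) = weight_at u (\<not> e)" and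
    alt: "(lookup u 0, Send b, lookup v 0) \<in> trans P False \<and> lookup v 1 = lookup u 1 \<and>
        content_at v e = content_at u e + b * weight_at u e \<and>
        weight_at v e = Suc c * weight_at u e \<or>
      (lookup u 1, Recv b, lookup v 1) \<in> trans P True \<and> lookup v 0 = lookup u 0 \<and>
        content_at u e = b + Suc c * content_at v e \<and>
        weight_at u e = Suc c * weight_at v e"
    using assms(2) unfolding step_code_iff by blast
  have v: "represents v T' (C(e := x))"
    if "lookup v 0 = T' False" "lookup v 1 = T' True" "content_at v e = chan_val (Suc c) x"
      "weight_at v e = Suc c ^ length x" "set x \<subseteq> msgs P e"
    for T' x
  proof -
    have "content_at v j = chan_val (Suc c) ((C(e := x)) j) \<and>
        weight_at v j = Suc c ^ length ((C(e := x)) j) \<and> set ((C(e := x)) j) \<subseteq> msgs P j" for j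
    proof (cases "j = e")
      case True
      then show ?thesis using that by simp
    next
      case False
      then have "j = (\<not> e)" by blast
      then show ?thesis using that same u unfolding represents_def by auto
    qed
    then show ?thesis using that unfolding represents_def by blast
  qed
  from alt show ?thesis
  proof (elim disjE conjE)
    assume *: "(lookup u 0, Send b, lookup v 0) \<in> trans P False" "lookup v 1 = lookup u 1"
      "content_at v e = content_at u e + b * weight_at u e"
      "weight_at v e = Suc c * weight_at u e"
    have "step P (T, C) (T(False := lookup v 0), C(e := C e @ [b]))"
      using * u b by (intro step_send) (auto simp: represents_def)
    moreover have "represents v (T(False := lookup v 0)) (C(e := C e @ [b]))"
      using * u b by (intro v) (auto simp: represents_def chan_val_snoc)
    ultimately show ?thesis by blast
  next
    assume *: "(lookup u 1, Recv b, lookup v 1) \<in> trans P True" "lookup v 0 = lookup u 0"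
      "content_at u e = b + Suc c * content_at v e"
      "weight_at u e = Suc c * weight_at v e"
    have ue: "content_at u e = chan_val (Suc c) (C e)"
      "weight_at u e = Suc c ^ length (C e)" "set (C e) \<subseteq> msgs P e"
      using u by (auto simp: represents_def)
    \<comment> \<open>By numerals alone, message 0 could be received from an empty channel; but the
      weight of an empty channel is 1, which is no multiple of the base.\<close>
    have "C e \<noteq> []"
    proof
      assume "C e = []"
      then have "Suc c * weight_at v e = 1" using ue(2) *(4) by simp
      then show False using c_pos by (simp del: mult_Suc)
    qed
    then obtain a x where ax: "C e = a # x" by (cases "C e") auto
    then have bounds: "a \<le> c" "b \<le> c" using ue(3) b msg_bound by auto
    have eq: "b + Suc c * content_at v e = a + Suc c * chan_val (Suc c) x"
      using ue(1) *(3) ax by simp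
    \<comment> \<open>Messages are smaller than the base, so the least significant digit is unique
      and the received message is the first one in the channel.\<close>
    have "b = (b + Suc c * content_at v e) mod Suc c" using bounds by (simp del: mult_Suc)
    also have "\<dots> = a" unfolding eq using bounds by (simp del: mult_Suc)
    finally have "b = a" .
    with eq have "content_at v e = chan_val (Suc c) x" by (simp del: mult_Suc)
    moreover have "weight_at v e = Suc c ^ length x"
      using ue(2) *(4) ax by (simp del: mult_Suc)
    ultimately have "represents v (T(True := lookup v 1)) (C(e := x))"
      using *(2) u ue(3) ax by (intro v) (auto simp: represents_def)
    moreover have "step P (T, C) (T(True := lookup v 1), C(e := x))"
      using * u b ax \<open>b = a\<close> by (intro step_recv) (auto simp: represents_def)
    ultimately show ?thesis by blast
  qed
qed

lemma reachable_step: "reachable P g \<Longrightarrow> step P g h \<Longrightarrow> reachable P h"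
  by (simp add: reachable_def)

lemma reachable_msgs:
  assumes "reachable P (T, C)"
  shows "set (C e) \<subseteq> msgs P e"
proof -
  have "\<forall>e. set (C e) \<subseteq> msgs P e"
    using assms unfolding reachable_def
  proof (induction rule: rtranclp_induct2)
    case refl
    show ?case by (simp add: empty_chan_def)
  next
    case (step T C T' C')
    from step.hyps(2) show ?case
    proof (cases rule: step_cases)
      case (Send e b q)
      then show ?thesis using step.IH by auto
    next
      case (Recv e b q x)
      then have "set x \<subseteq> msgs P e" using step.IH[rule_format, of e] by auto
      then show ?thesis using Recv step.IH by auto
    qed
  qed
  then show ?thesis by blast
qed

lemma stable_iff_witness: "stable P S \<longleftrightarrow> (\<exists>w. stable_witness c w)"
proof -
  let ?u = "config_code (init P) empty_chan"
  have "(step_code c)\<^sup>*\<^sup>* ?u (config_code T C)" if "reachable P (T, C)" for T C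
    using that unfolding reachable_def
  proof (induction rule: rtranclp_induct2)
    case refl
    show ?case by simp
  next
    case (step T C T' C')
    have "reachable P (T, C)" "reachable P (T', C')"
      using step.hyps by (auto simp: reachable_def)
    then have "step_code c (config_code T C) (config_code T' C')"
      using step.hyps(2) by (meson represents_config_code reachable_msgs step_imp_step_code)
    with step.IH show ?case by simp
  qed
  then have "(step_code c)\<^sup>*\<^sup>* ?u (config_code S empty_chan)" if "stable P S"
    using that by (simp add: stable_def)
  moreover have "stable P S" if "(step_code c)\<^sup>*\<^sup>* ?u (config_code S empty_chan)"
  proof -
    have "\<exists>T C. reachable P (T, C) \<and> represents v T C" if "(step_code c)\<^sup>*\<^sup>* ?u v" for v
      using that
    proof (induction rule: rtranclp_induct)
      case base
      have "reachable P (init P, empty_chan)" by (simp add: reachable_def)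
      then show ?case using represents_config_code reachable_msgs by meson
    next
      case (step v w)
      then show ?case using step_code_imp_step reachable_step by meson
    qed
    from this[OF that] show ?thesis
      using represents_empty unfolding stable_def by metis
  qed
  ultimately show ?thesis unfolding stable_witness_iff lookup_c config_code_empty by blast
qed

end

section \<open>Correctness of instability certificates\<close>

text \<open>The invariant for soundness: a configuration arises from one with an empty channel that is
  admitted by the certificate, followed by sends only.\<close>

inductive covered :: "(bool, bool, nat, nat) cfsm \<Rightarrow> nat \<Rightarrow> (bool \<Rightarrow> nat \<Rightarrow> nat \<Rightarrow> nat list \<Rightarrow> bool) \<Rightarrow>
    nat \<Rightarrow> nat \<Rightarrow> (bool \<Rightarrow> nat list) \<Rightarrow> bool" for P c Q where
  base: "Q k p q x \<Longrightarrow> set x \<subseteq> msgs P k \<Longrightarrow> p \<le> c \<Longrightarrow> q \<le> c \<Longrightarrow> covered P c Q p q (empty_chan(k := x))"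
| send: "covered P c Q p q C \<Longrightarrow> b \<in> msgs P e \<Longrightarrow> (p, Send b, p') \<in> trans P False \<Longrightarrow>
    covered P c Q p' q (C(e := C e @ [b]))"

context two_channel
begin

lemma separator_iff:
  "separator c N e l r D \<longleftrightarrow>
     e < N \<and>
     (\<forall>a\<le>c. l a e = r a e) \<and>
     (\<forall>a\<le>c. \<forall>z<N. l a z < N) \<and>
     (\<forall>a\<le>c. \<forall>b\<le>c. \<forall>z<N. l b (r a z) = r a (l b z)) \<and>
     D 0 (init P False) (init P True) e \<and>
     \<not> D 0 (S False) (S True) e \<and>
     (\<forall>k. \<forall>p\<le>c. \<forall>q\<le>c. D (of_bool k) p q e \<longrightarrow> D (of_bool (\<not> k)) p q e) \<and>
     (\<forall>k. \<forall>p\<le>c. \<forall>q\<le>c. \<forall>z<N. \<forall>a\<in>msgs P k. \<forall>p'. D (of_bool k) p q z \<longrightarrow>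
        (p, Send a, p') \<in> trans P False \<longrightarrow> D (of_bool k) p' q (r a z)) \<and>
     (\<forall>k. \<forall>p\<le>c. \<forall>q\<le>c. \<forall>z<N. \<forall>a\<in>msgs P k. \<forall>q'. D (of_bool k) p q (l a z) \<longrightarrow>
        (q, Recv a, q') \<in> trans P True \<longrightarrow> D (of_bool k) p q' z) \<and>
     (\<forall>k. \<forall>p\<le>c. \<forall>q\<le>c. \<forall>z<N. \<forall>a\<in>msgs P (\<not> k). \<forall>p' q'. D (of_bool k) p q z \<longrightarrow>
        (p, Send a, p') \<in> trans P False \<longrightarrow> (q, Recv a, q') \<in> trans P True \<longrightarrow>
        D (of_bool k) p' q' z)"
proof -
  have bounds: "a \<in> msgs P k \<Longrightarrow> a \<le> c" "(p, x, p') \<in> trans P j \<Longrightarrow> p' \<le> c" for a k p x p' j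
    using msg_bound trans_states state_bound by blast+
  show ?thesis
    unfolding separator_def all_less_two_iff one_minus_of_bool msg_code_iff send_code_iff
      recv_code_iff lookup_c
    by (intro conj_cong refl iffI allI impI ballI; (meson bounds)?)
qed

text \<open>Reachable configurations are \<open>covered\<close>. Sends preserve this by definition;
  a receive is moved back in front of the trailing sends. A stable state has both channels empty, so
  its membership in the family can be read off, against the exclusion in the certificate.\<close>

lemma separator_imp_unstable:
  assumes sep: "separator c N e l r D"
  shows "\<not> stable P S"
proof
  note sep = sep[unfolded separator_iff]
  note closed = sep[THEN conjunct2, THEN conjunct2, THEN conjunct2, THEN conjunct2, THEN conjunct2,
      THEN conjunct2]
  have swap_D: "D (of_bool (\<not> k)) p q e" if "D (of_bool k) p q e" "p \<le> c" "q \<le> c" for k p q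
    using closed[THEN conjunct1] that by blast
  have send_D: "D (of_bool k) p' q (r a z)"
    if "D (of_bool k) p q z" "a \<in> msgs P k" "(p, Send a, p') \<in> trans P False" "p \<le> c" "q \<le> c" "z < N"
    for k p q a p' z
    using closed[THEN conjunct2, THEN conjunct1] that by blast
  have recv_D: "D (of_bool k) p q' z"
    if "D (of_bool k) p q (l a z)" "a \<in> msgs P k" "(q, Recv a, q') \<in> trans P True" "p \<le> c" "q \<le> c" "z < N"
    for k p q a q' z
    using closed[THEN conjunct2, THEN conjunct2, THEN conjunct1] that by blast
  have pass_D: "D (of_bool k) p' q' z"
    if "D (of_bool k) p q z" "a \<in> msgs P (\<not> k)" "(p, Send a, p') \<in> trans P False"
      "(q, Recv a, q') \<in> trans P True" "p \<le> c" "q \<le> c" "z < N"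
    for k p q a p' q' z
    using closed[THEN conjunct2, THEN conjunct2, THEN conjunct2] that by blast
  define cl where "cl x = foldr l x e" for x
  define Q where "Q k p q x = D (of_bool k) p q (cl x)" for k p q x
  have cl_less: "cl x < N" if "set x \<subseteq> {..c}" for x
    using that by (induction x) (use sep in \<open>auto simp: cl_def\<close>)
  \<comment> \<open>\<open>cl\<close> is built by adding letters on the left; the commutation law
    carries a letter added on the right through to the empty word, where \<open>l\<close> and
    \<open>r\<close> agree.\<close>
  have cl_snoc: "cl (x @ [a]) = r a (cl x)" if "set x \<subseteq> {..c}" "a \<le> c" for x a
    using that(1)
  proof (induction x)
    case Nil
    then show ?case using sep that(2) by (simp add: cl_def)
  next
    case (Cons b x)
    then have "l b (r a (cl x)) = r a (l b (cl x))"
      using sep that(2) cl_less[of x] by simp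
    with Cons show ?case by (simp add: cl_def)
  qed
  have msgs_bound: "msgs P k \<subseteq> {..c}" for k using msg_bound by auto
  have cov_bound: "p \<le> c \<and> q \<le> c" if "covered P c Q p q C" for p q C
    using that by induction (use trans_states state_bound in blast)+
  \<comment> \<open>If the other channel is empty, every trailing send went to channel
    \<open>k\<close>, and the send rule absorbs it. A base that uses the other channel must carry
    the empty word, and the exchange rule applies.\<close>
  have one_empty: "Q k p q (C k) \<and> set (C k) \<subseteq> msgs P k"
    if "covered P c Q p q C" "C (\<not> k) = []" for p q C k
    using that
  proof (induction arbitrary: k)
    case (base j p q x)
    show ?case
    proof (cases "j = k")
      case True
      then show ?thesis using base by simp
    next
      case False
      then have j: "j = (\<not> k)" by blast
      then have "x = []" using base by simp
      with base j have "D (of_bool (\<not> k)) p q e" by (simp only: Q_def cl_def foldr_Nil id_apply)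
      from swap_D[OF this] base.hyps j show ?thesis by (simp add: Q_def cl_def empty_chan_def)
    qed
  next
    case (send p q C b j p')
    from send.prems have j: "j = k" "C (\<not> k) = []"
      by (auto simp: fun_upd_def split: if_splits)
    have IH: "Q k p q (C k)" "set (C k) \<subseteq> msgs P k" using send.IH[OF j(2)] by auto
    then have Ck: "set (C k) \<subseteq> {..c}" using msgs_bound by blast
    have pq: "p \<le> c" "q \<le> c" using cov_bound[OF send.hyps(1)] by auto
    have "D (of_bool k) p' q (r b (cl (C k)))"
      using send_D[of k p q "cl (C k)" b p'] IH(1) send.hyps(2,3) j(1) pq cl_less[OF Ck]
      by (simp only: Q_def)
    moreover have "b \<le> c" using send.hyps(2) msg_bound by blast
    ultimately show ?case
      using IH(2) send.hyps(2) j(1) cl_snoc[OF Ck] by (simp add: Q_def)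
  qed
  \<comment> \<open>The receive commutes with each trailing send, back to the base, unless a send
    supplies the very message consumed.\<close>
  have recv: "covered P c Q p q' (C(j := x))"
    if "covered P c Q p q C" "C j = a # x" "a \<in> msgs P j" "(q, Recv a, q') \<in> trans P True"
    for p q q' C j a x
    using that
  proof (induction arbitrary: x)
    case (base k p q y)
    then have k: "k = j" "y = a # x" by (auto simp: empty_chan_def fun_upd_def split: if_splits)
    then have x: "set x \<subseteq> msgs P j" using base by simp
    then have "cl x < N" using msgs_bound cl_less by blast
    moreover have "D (of_bool j) p q (l a (cl x))" using base k by (simp add: Q_def cl_def)
    ultimately have "D (of_bool j) p q' (cl x)"
      using recv_D base.hyps(3,4) base.prems(2,3) by blast
    moreover have "q' \<le> c" using base.prems(3) trans_states state_bound by blast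
    ultimately have "covered P c Q p q' (empty_chan(j := x))"
      using x base.hyps(3) by (intro covered.base) (simp_all add: Q_def)
    then show ?case by (simp only: k fun_upd_upd)
  next
    case (send p q C b k p')
    have bounds: "p \<le> c" "q \<le> c" using cov_bound[OF send.hyps(1)] by auto
    have bounds': "p' \<le> c" "q' \<le> c"
      using send.hyps(3) send.prems(3) trans_states state_bound by blast+
    show ?case
    proof (cases "k = j")
      case False
      then have "C j = a # x" using send.prems(1) by simp
      moreover have "(C(k := C k @ [b]))(j := x) = (C(j := x))(k := (C(j := x)) k @ [b])"
        using False by (auto simp: fun_eq_iff)
      ultimately show ?thesis
        using covered.send[OF send.IH[OF _ send.prems(2,3)] send.hyps(2,3)] by metis
    next
      case True
      show ?thesis
      proof (cases "C j")
        case Nil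
        then have ab: "b = a" "x = []" using send.prems(1) True by auto
        have E: "Q (\<not> j) p q (C (\<not> j))" "set (C (\<not> j)) \<subseteq> msgs P (\<not> j)"
          using one_empty[OF send.hyps(1), of "\<not> j"] Nil by auto
        have less: "cl (C (\<not> j)) < N" using E(2) msgs_bound cl_less by blast
        have a: "a \<in> msgs P (\<not> \<not> j)" using send.prems(2) by simp
        from E(1) have "D (of_bool (\<not> j)) p q (cl (C (\<not> j)))" by (simp only: Q_def)
        from pass_D[OF this a send.hyps(3)[unfolded ab(1)] send.prems(3) bounds less]
        have "D (of_bool (\<not> j)) p' q' (cl (C (\<not> j)))" .
        then have "covered P c Q p' q' (empty_chan((\<not> j) := C (\<not> j)))"
          unfolding Q_def[symmetric] using E(2) bounds' by (rule covered.base)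
        moreover have "empty_chan((\<not> j) := C (\<not> j)) = (C(k := C k @ [b]))(j := x)"
          using True ab by (auto simp: empty_chan_def fun_eq_iff)
        ultimately show ?thesis by (simp only:)
      next
        case (Cons a' x')
        then have x: "a' = a" "x = x' @ [b]" using send.prems(1) True by auto
        have "C j = a # x'" using Cons x by simp
        moreover have "(C(k := C k @ [b]))(j := x) = (C(j := x'))(k := (C(j := x')) k @ [b])"
          using True x by (auto simp: fun_eq_iff)
        ultimately show ?thesis
          using covered.send[OF send.IH[OF _ send.prems(2,3)] send.hyps(2,3)] by metis
      qed
    qed
  qed
  have "covered P c Q (T False) (T True) C" if "reachable P (T, C)" for T C
    using that unfolding reachable_def
  proof (induction rule: rtranclp_induct2)
    case refl
    have "Q False (init P False) (init P True) []" using sep by (simp add: Q_def cl_def)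
    then show ?case
      using covered.base[of Q False "init P False" "init P True" "[]" P c]
        state_bound[OF init_states[of False]] state_bound[OF init_states[of True]]
      by (simp add: empty_chan_def fun_upd_idem)
  next
    case (step T C T' C')
    from step.hyps(2) show ?case
    proof (cases rule: step_cases)
      case (Send e b q)
      from covered.send[OF step.IH Send(1,2)] show ?thesis
        unfolding Send(3,4) by (simp only: fun_upd_same fun_upd_other simp_thms)
    next
      case (Recv e b q x)
      from recv[OF step.IH Recv(3,1,2)] show ?thesis
        unfolding Recv(4,5) by (simp only: fun_upd_same fun_upd_other simp_thms)
    qed
  qed
  moreover assume "stable P S"
  ultimately have "Q False (S False) (S True) []"
    using one_empty[of "S False" "S True" empty_chan False] by (simp add: stable_def empty_chan_def)
  then show False using sep by (simp add: Q_def cl_def)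
qed

text \<open>The exact languages of reachable words satisfy the rules, since each rule is realised by
  at most two steps of the protocol. Rationality makes them regular, so one finite congruence
  saturates all of them and they become tables on its classes.\<close>

lemma unstable_imp_cert:
  assumes rat: "rational_channel_property P" and unst: "\<not> stable P S"
  shows "\<exists>w. unstable_cert c w"
proof -
  define st where "st p q = (\<lambda>j. if j then q else p)" for p q :: nat
  define L where "L = (\<lambda>(k, p, q). slice k (chanL P (st p q)))"
  define I where "I = (UNIV :: bool set) \<times> states P False \<times> states P True"
  have fin: "finite I" unfolding I_def by (intro finite_cartesian_product finite_states) simp
  have reg: "regular (L i)" if "i \<in> I" for i
  proof -
    obtain k p q where i: "i = (k, p, q)" by (cases i)
    then have "composite_state P (st p q)"
      using that by (auto simp: I_def composite_state_def st_def)
    then have "chanL P (st p q) \<in> rational_sets (chan_monoid P)"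
      using rat by (simp add: rational_channel_property_def)
    then show ?thesis unfolding i L_def by (simp add: regular_slice)
  qed
  obtain N :: nat and \<nu> :: "nat list \<Rightarrow> nat" where range: "range \<nu> = {..<N}"
    and cong: "\<And>x y u v. \<nu> x = \<nu> y \<Longrightarrow> \<nu> (u @ x @ v) = \<nu> (u @ y @ v)"
    and sat: "\<And>i x y. i \<in> I \<Longrightarrow> \<nu> x = \<nu> y \<Longrightarrow> x \<in> L i \<Longrightarrow> y \<in> L i"
    using finite_congruence[of I L, OF fin reg] by metis
  have in_L: "x \<in> L (k, p, q) \<longleftrightarrow> reachable P (st p q, empty_chan(k := x))" for k p q x
    by (simp add: L_def slice_def chanL_def)
  have \<nu>_less: "\<nu> x < N" for x using range by auto
  \<comment> \<open>A table acts on classes through representatives; by congruence and saturation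
    the choice does not matter.\<close>
  define rep where "rep z = (SOME x. \<nu> x = z)" for z
  have rep: "\<nu> (rep (\<nu> x)) = \<nu> x" for x unfolding rep_def by (rule someI) simp
  have st_upd: "(st p q)(False := p') = st p' q" "(st p q)(True := q') = st p q'" for p q p' q'
    by (auto simp: st_def)
  have st_simps: "st p q False = p" "st p q True = q" for p q by (simp_all add: st_def)
  \<comment> \<open>Stated for any tables that are right on arguments up to \<open>c\<close>: a
    coded table is correct on finitely many entries only, and the closure argument stays free of
    codes.\<close>
  have sep: "separator c N (\<nu> []) l r D"
    if l: "\<And>a x. a \<le> c \<Longrightarrow> l a (\<nu> x) = \<nu> (a # x)"
      and r: "\<And>a x. a \<le> c \<Longrightarrow> r a (\<nu> x) = \<nu> (x @ [a])"
      and D: "\<And>k p q x. p \<le> c \<Longrightarrow> q \<le> c \<Longrightarrow>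
        D (of_bool k) p q (\<nu> x) \<longleftrightarrow> (k, p, q) \<in> I \<and> x \<in> L (k, p, q)"
    for l r D
  proof -
    have all: "(\<forall>z<N. R z) \<longleftrightarrow> (\<forall>x. R (\<nu> x))" for R
      using range by (metis lessThan_iff rangeE rangeI)
    have D0: "D 0 p q (\<nu> x) \<longleftrightarrow> (False, p, q) \<in> I \<and> x \<in> L (False, p, q)" if "p \<le> c" "q \<le> c" for p q x
      using D[OF that, of False] by simp
    have S_states: "S j \<in> states P j" for j
      using comp graph by (auto simp: composite_state_def two_parallel_graph_def)
    have eq: "empty_chan(k := []) = (empty_chan :: bool \<Rightarrow> nat list)" for k
      by (auto simp: empty_chan_def)
    have init: "D 0 (init P False) (init P True) (\<nu> [])"
    proof -
      have "st (init P False) (init P True) = init P" by (auto simp: st_def)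
      then have "[] \<in> L (False, init P False, init P True)"
        unfolding in_L eq by (simp add: reachable_def)
      then show ?thesis
        using init_states state_bound by (subst D0) (auto simp: I_def)
    qed
    have final: "\<not> D 0 (S False) (S True) (\<nu> [])"
    proof -
      have "st (S False) (S True) = S" by (auto simp: st_def)
      then have "[] \<notin> L (False, S False, S True)"
        using unst unfolding in_L eq by (simp add: stable_def)
      then show ?thesis
        using S_states state_bound by (subst D0) auto
    qed
    have swap: "D (of_bool (\<not> k)) p q (\<nu> [])"
      if "p \<le> c" "q \<le> c" "D (of_bool k) p q (\<nu> [])" for k p q
      using that(3) unfolding D[OF that(1,2)] in_L eq by (simp add: I_def)
    have send: "D (of_bool k) p' q (r a (\<nu> x))"
      if "p \<le> c" "q \<le> c" "a \<in> msgs P k" "D (of_bool k) p q (\<nu> x)" "(p, Send a, p') \<in> trans P False"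
      for k p q x a p'
    proof -
      have p': "p' \<le> c" "p' \<in> states P False" "a \<le> c"
        using trans_states[OF that(5)] state_bound msg_bound[OF that(3)] by auto
      have "step P (st p q, empty_chan(k := x)) (st p' q, empty_chan(k := x @ [a]))"
        using step_send[OF that(3), of "st p q" p' "empty_chan(k := x)"] that(5)
        by (simp add: st_upd st_simps)
      then show ?thesis
        using that(4) p' unfolding r[OF p'(3)] D[OF that(1,2)] D[OF p'(1) that(2)] in_L
        by (auto simp: I_def intro: reachable_step)
    qed
    have recv: "D (of_bool k) p q' (\<nu> x)"
      if "p \<le> c" "q \<le> c" "a \<in> msgs P k" "D (of_bool k) p q (l a (\<nu> x))" "(q, Recv a, q') \<in> trans P True"
      for k p q x a q'
    proof -
      have q': "q' \<le> c" "q' \<in> states P True" "a \<le> c"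
        using trans_states[OF that(5)] state_bound msg_bound[OF that(3)] by auto
      have "step P (st p q, empty_chan(k := a # x)) (st p q', empty_chan(k := x))"
        using step_recv[OF that(3), of "st p q" q' "empty_chan(k := a # x)" x] that(5)
        by (simp add: st_upd st_simps)
      then show ?thesis
        using that(4) q' unfolding l[OF q'(3)] D[OF that(1,2)] D[OF that(1) q'(1)] in_L
        by (auto simp: I_def intro: reachable_step)
    qed
    have pass: "D (of_bool k) p' q' (\<nu> x)"
      if "p \<le> c" "q \<le> c" "a \<in> msgs P (\<not> k)" "D (of_bool k) p q (\<nu> x)"
        "(p, Send a, p') \<in> trans P False" "(q, Recv a, q') \<in> trans P True"
      for k p q x a p' q'
    proof -
      have p': "p' \<le> c" "p' \<in> states P False" using trans_states[OF that(5)] state_bound by auto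
      have q': "q' \<le> c" "q' \<in> states P True" using trans_states[OF that(6)] state_bound by auto
      let ?C = "empty_chan(k := x, (\<not> k) := [a])"
      have "step P (st p q, empty_chan(k := x)) (st p' q, ?C)"
        using step_send[OF that(3), of "st p q" p' "empty_chan(k := x)"] that(5)
        by (simp add: st_upd st_simps empty_chan_def)
      moreover have "step P (st p' q, ?C) (st p' q', empty_chan(k := x))"
      proof -
        have "?C((\<not> k) := []) = empty_chan(k := x)" by (auto simp: empty_chan_def fun_eq_iff)
        moreover have "step P (st p' q, ?C) ((st p' q)(True := q'), ?C((\<not> k) := []))"
          by (rule step_recv[OF that(3)]) (use that(6) in \<open>simp_all add: st_simps\<close>)
        ultimately show ?thesis by (simp only: st_upd)
      qed
      ultimately show ?thesis
        using that(4) p' q' unfolding D[OF that(1,2)] D[OF p'(1) q'(1)] in_L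
        by (auto simp: I_def intro: reachable_step)
    qed
    show ?thesis
      unfolding separator_iff all
    proof (intro conjI \<nu>_less init final)
      show "\<forall>a\<le>c. l a (\<nu> []) = r a (\<nu> [])" by (simp add: l r)
      show "\<forall>a\<le>c. \<forall>x. l a (\<nu> x) < N" by (simp add: l \<nu>_less)
      show "\<forall>a\<le>c. \<forall>b\<le>c. \<forall>x. l b (r a (\<nu> x)) = r a (l b (\<nu> x))" by (simp add: l r)
    qed (use swap in blast, use send in blast, use recv in blast, use pass in blast)
  qed
  let ?d1 = "\<lambda>i. fst (prod_decode i)" and ?d2 = "\<lambda>i. snd (prod_decode i)"
  \<comment> \<open>\<open>Z\<close> and \<open>Y\<close> collect the finitely many arguments at
    which a certificate is consulted.\<close>
  define Z where "Z = case_prod pair ` ({..c} \<times> {..<N})"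
  have Z: "finite Z" "a \<le> c \<Longrightarrow> pair a (\<nu> x) \<in> Z" for a x
    using \<nu>_less by (auto simp: Z_def)
  obtain tl where tl: "\<forall>i\<in>Z. lookup tl i = \<nu> (?d1 i # rep (?d2 i))"
    using lookup_table_finite[OF Z(1)] ..
  obtain tr where tr: "\<forall>i\<in>Z. lookup tr i = \<nu> (rep (?d2 i) @ [?d1 i])"
    using lookup_table_finite[OF Z(1)] ..
  define Y where "Y = (\<lambda>(k, p, q, z). pair k (pair p (pair q z))) ` ({..1} \<times> {..c} \<times> {..c} \<times> {..<N})"
  have Y: "finite Y" "p \<le> c \<Longrightarrow> q \<le> c \<Longrightarrow> pair (of_bool k) (pair p (pair q (\<nu> x))) \<in> Y" for k p q x
  proof -
    show "finite Y" unfolding Y_def by (intro finite_imageI finite_cartesian_product) auto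
    assume "p \<le> c" "q \<le> c"
    then show "pair (of_bool k) (pair p (pair q (\<nu> x))) \<in> Y"
      unfolding Y_def using \<nu>_less by (intro image_eqI[of _ _ "(of_bool k, p, q, \<nu> x)"]) auto
  qed
  define F where "F k p q z = (of_bool ((k \<noteq> 0, p, q) \<in> I \<and> rep z \<in> L (k \<noteq> 0, p, q)) :: nat)"
    for k p q z :: nat
  obtain td where td: "\<forall>i\<in>Y. lookup td i = F (?d1 i) (?d1 (?d2 i)) (?d1 (?d2 (?d2 i))) (?d2 (?d2 (?d2 i)))"
    using lookup_table_finite[OF Y(1)] ..
  have dec: "?d1 (pair a b) = a" "?d2 (pair a b) = b" for a b by (simp_all add: pair_def)
  have "separator c N (\<nu> []) (\<lambda>a z. lookup tl (pair a z)) (\<lambda>a z. lookup tr (pair a z))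
      (\<lambda>k p q z. 0 < lookup td (pair k (pair p (pair q z))))"
  proof (rule sep)
    fix a x assume a: "a \<le> c"
    show "lookup tl (pair a (\<nu> x)) = \<nu> (a # x)"
      using tl Z(2)[OF a, of x] cong[OF rep, of "[a]" x "[]"] by (simp add: dec)
    show "lookup tr (pair a (\<nu> x)) = \<nu> (x @ [a])"
      using tr Z(2)[OF a, of x] cong[OF rep, of "[]" x "[a]"] by (simp add: dec)
  next
    fix k p q x assume pq: "p \<le> c" "q \<le> c"
    have "rep (\<nu> x) \<in> L (k, p, q) \<longleftrightarrow> x \<in> L (k, p, q)" if "(k, p, q) \<in> I"
      using sat[OF that] rep by metis
    then show "0 < lookup td (pair (of_bool k) (pair p (pair q (\<nu> x)))) \<longleftrightarrow>
        (k, p, q) \<in> I \<and> x \<in> L (k, p, q)"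
      using td Y(2)[OF pq, of k x] by (auto simp: dec F_def)
  qed
  then have "unstable_cert c (list_encode [N, \<nu> [], tl, tr, td])"
    unfolding unstable_cert_def lookup_list_encode by simp
  then show ?thesis ..
qed

end

theorem theorem10p3:
  "\<exists>f :: recf. \<forall>(P :: (bool, bool, nat, nat) cfsm) (S :: bool \<Rightarrow> nat).
     wf_cfsm P \<and> two_parallel_graph P \<and> rational_channel_property P \<and> composite_state P S
     \<longrightarrow> eval f [encode_instance P S] (if stable P S then 1 else 0)"
proof -
  \<comment> \<open>The program comes from the decidability of the two witness relations alone,
    before any protocol is fixed, so it is uniform in the instance.\<close>
  obtain f where f: "\<And>c b. (\<exists>w. stable_witness c w \<or> unstable_cert c w) \<Longrightarrow>
      (\<And>w. stable_witness c w \<Longrightarrow> b) \<Longrightarrow> (\<And>w. unstable_cert c w \<Longrightarrow> \<not> b) \<Longrightarrow>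
      eval f [c] (of_bool b)"
    using decide_by_search[OF decidable_stable_witness decidable_unstable_cert] by blast
  show ?thesis
  proof (intro exI allI impI, elim conjE)
    fix P :: "(bool, bool, nat, nat) cfsm" and S :: "bool \<Rightarrow> nat"
    assume P: "wf_cfsm P" "two_parallel_graph P" "rational_channel_property P" "composite_state P S"
    interpret two_channel P S "encode_instance P S"
      using P by unfold_locales simp_all
    have "eval f [encode_instance P S] (of_bool (stable P S))"
    proof (rule f)
      show "\<exists>w. stable_witness (encode_instance P S) w \<or> unstable_cert (encode_instance P S) w"
        using stable_iff_witness unstable_imp_cert[OF P(3)] by blast
      show "stable_witness (encode_instance P S) w \<Longrightarrow> stable P S" for w
        using stable_iff_witness by blast
      show "unstable_cert (encode_instance P S) w \<Longrightarrow> \<not> stable P S" for w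
        unfolding unstable_cert_def by (rule separator_imp_unstable)
    qed
    then show "eval f [encode_instance P S] (if stable P S then 1 else 0)"
      by (simp add: of_bool_def)
  qed
qed

end
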